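(* Assume $f_j'(u)+1\ne0$ and $f_j''(u)\neq0$ for all $u\in\mathbb R$ and all $1\le j\le k$. For an integer $\ell\ge1$ define the function on $\mathcal M_F$ $$\beta_\ell=\sum_{j=1}^k\frac{f_j^{(\ell+1)}(u_j)\,\bigl(1+f_j'(u_j)\bigr)^{\ell-1}}{\bigl(f_j''(u_j)\bigr)^{\ell}}.$$ (1) $\beta_\ell$ is an $\ell$-model invariant: if $F'$ is another $k$-tuple of functions satisfying the same hypotheses (with the same signs $\varepsilon_i$), $P\in\mathcal M_F$, $Q\in\mathcal M_{F'}$, and $\Phi:T_P\mathcal M_F\to T_Q\mathcal M_{F'}$ is a linear isometry with $\Phi^*(\nabla^iR)_Q=(\nabla^iR)_P$ for $0\le i\le\ell$, then $\beta_\ell^{F}(P)=\beta_\ell^{F'}(Q)$. (2) If $\mathcal M_F$ is $\ell$-curvature homogeneous, then $\beta_p$ is constant on $\mathcal M_F$ for every $p=1,\dots,\ell$. (3) If $\mathcal M_F$ is locally homogeneous, then $\beta_\ell$ is constant for every $\ell\ge1$.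
   Context: Fix an integer $k\ge 1$ and signs $\varepsilon_1,\dots,\varepsilon_k\in\{\pm1\}$. Let $f_1,\dots,f_k:\mathbb R\to\mathbb R$ be smooth, $F=(f_1,\dots,f_k)$. On $\mathbb R^{3k+2}$ with coordinates $(u_0,\dots,u_k,v_0,\dots,v_k,s_1,\dots,s_k)$ let $g_F$ be the symmetric metric whose only nonzero components on coordinate vector fields are (up to symmetry), for $1\le i\le k$ and $0\le i',j\le k$: $g_F(\partial_{u_0},\partial_{u_i})=2f_i(u_i)s_i$, $g_F(\partial_{u_i},\partial_{u_i})=-2u_0s_i$, $g_F(\partial_{u_{i'}},\partial_{v_j})=\delta_{i'j}$, $g_F(\partial_{s_i},\partial_{s_i})=\varepsilon_i$; $\mathcal M_F=(\mathbb R^{3k+2},g_F)$. $\nabla$ is the Levi-Civita connection, $R(X,Y,Z,W)=g_F(\nabla_X\nabla_YZ-\nabla_Y\nabla_XZ-\nabla_{[X,Y]}Z,W)$, $\nabla^0R=R$ and $\nabla^\ell R(X_1,\dots,X_4;Y_1,\dots,Y_\ell)=(\nabla_{Y_\ell}\nabla^{\ell-1}R)(X_1,\dots,X_4;Y_1,\dots,Y_{\ell-1})$. A pseudo-Riemannian manifold $(M,g)$ is $\ell$-curvature homogeneous if for all $P,Q\in M$ there is a linear isometry $\Phi:T_PM\to T_QM$ with $\Phi^*(\nabla^iR)_Q=(\nabla^iR)_P$ for $i=0,\dots,\ell$. It is locally homogeneous if for all $P,Q$ there is an isometry between neighborhoods of $P$ and $Q$ sending $P$ to $Q$. *)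

theory Defs
  imports "HOL-Analysis.Analysis"
begin

text \<open>Points of R^N are functions nat => real vanishing at indices >= N.
  Tangent vectors are represented the same way (components in the
  coordinate frame).  Vector fields map points to component vectors.\<close>

type_synonym pt = "nat \<Rightarrow> real"
type_synonym vfield = "pt \<Rightarrow> pt"
type_synonym metric = "pt \<Rightarrow> nat \<Rightarrow> nat \<Rightarrow> real"
type_synonym tensor = "vfield list \<Rightarrow> pt \<Rightarrow> real"

definition pts :: "nat \<Rightarrow> pt set" where
  "pts N = {x. \<forall>i\<ge>N. x i = 0}"

definition pd :: "(pt \<Rightarrow> real) \<Rightarrow> nat \<Rightarrow> pt \<Rightarrow> real" where
  "pd h i x = deriv (\<lambda>t. h (x(i := x i + t))) 0"

fun pd_iter :: "nat list \<Rightarrow> (pt \<Rightarrow> real) \<Rightarrow> pt \<Rightarrow> real" where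
  "pd_iter [] h = h"
| "pd_iter (i # is) h = pd (pd_iter is h) i"

definition smooth_on :: "nat \<Rightarrow> pt set \<Rightarrow> (pt \<Rightarrow> real) \<Rightarrow> bool" where
  "smooth_on N U h \<longleftrightarrow>
     (\<forall>is. set is \<subseteq> {..<N} \<longrightarrow>
        continuous_on U (pd_iter is h) \<and>
        (\<forall>x\<in>U. \<forall>i<N. (\<lambda>t. pd_iter is h (x(i := x i + t))) differentiable (at 0)))"

definition gval :: "nat \<Rightarrow> metric \<Rightarrow> pt \<Rightarrow> pt \<Rightarrow> pt \<Rightarrow> real" where
  "gval N g x v w = (\<Sum>a<N. \<Sum>b<N. g x a b * v a * w b)"

definition ginv :: "nat \<Rightarrow> metric \<Rightarrow> pt \<Rightarrow> nat \<Rightarrow> nat \<Rightarrow> real" where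
  "ginv N g x = (THE h. (\<forall>a c. (N \<le> a \<or> N \<le> c) \<longrightarrow> h a c = 0) \<and>
       (\<forall>a<N. \<forall>c<N. (\<Sum>b<N. g x a b * h b c) = (if a = c then 1 else 0)))"

definition chr1 :: "metric \<Rightarrow> nat \<Rightarrow> nat \<Rightarrow> nat \<Rightarrow> pt \<Rightarrow> real" where
  "chr1 g a b c x = (pd (\<lambda>y. g y b c) a x + pd (\<lambda>y. g y a c) b x - pd (\<lambda>y. g y a b) c x) / 2"

definition chr :: "nat \<Rightarrow> metric \<Rightarrow> nat \<Rightarrow> nat \<Rightarrow> nat \<Rightarrow> pt \<Rightarrow> real" where
  "chr N g e a b x = (\<Sum>c<N. ginv N g x e c * chr1 g a b c x)"

definition conn :: "nat \<Rightarrow> metric \<Rightarrow> vfield \<Rightarrow> vfield \<Rightarrow> vfield" where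
  "conn N g X Y = (\<lambda>x e. if e < N then
      (\<Sum>a<N. X x a * (pd (\<lambda>y. Y y e) a x + (\<Sum>b<N. chr N g e a b x * Y x b)))
    else 0)"

definition ddir :: "nat \<Rightarrow> vfield \<Rightarrow> (pt \<Rightarrow> real) \<Rightarrow> pt \<Rightarrow> real" where
  "ddir N X h x = (\<Sum>a<N. X x a * pd h a x)"

definition lie :: "nat \<Rightarrow> vfield \<Rightarrow> vfield \<Rightarrow> vfield" where
  "lie N X Y = (\<lambda>x e. if e < N then ddir N X (\<lambda>y. Y y e) x - ddir N Y (\<lambda>y. X y e) x else 0)"

definition curv :: "nat \<Rightarrow> metric \<Rightarrow> vfield \<Rightarrow> vfield \<Rightarrow> vfield \<Rightarrow> vfield \<Rightarrow> pt \<Rightarrow> real" where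
  "curv N g X Y Z W x = gval N g x
     (\<lambda>e. conn N g X (conn N g Y Z) x e - conn N g Y (conn N g X Z) x e
          - conn N g (lie N X Y) Z x e) (W x)"

definition curvT :: "nat \<Rightarrow> metric \<Rightarrow> tensor" where
  "curvT N g Xs = curv N g (Xs ! 0) (Xs ! 1) (Xs ! 2) (Xs ! 3)"

definition covD :: "nat \<Rightarrow> metric \<Rightarrow> tensor \<Rightarrow> vfield \<Rightarrow> tensor" where
  "covD N g T Y Xs x = ddir N Y (T Xs) x
      - (\<Sum>j<length Xs. T (Xs[j := conn N g Y (Xs ! j)]) x)"

fun nablaR :: "nat \<Rightarrow> metric \<Rightarrow> nat \<Rightarrow> tensor" where
  "nablaR N g 0 = curvT N g"
| "nablaR N g (Suc l) = (\<lambda>Xs. covD N g (nablaR N g l) (last Xs) (butlast Xs))"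

definition tensor_at :: "tensor \<Rightarrow> pt \<Rightarrow> pt list \<Rightarrow> real" where
  "tensor_at T x vs = T (map (\<lambda>v. \<lambda>_. v) vs) x"

definition lin_map :: "nat \<Rightarrow> (nat \<Rightarrow> nat \<Rightarrow> real) \<Rightarrow> pt \<Rightarrow> pt" where
  "lin_map N A v = (\<lambda>b. if b < N then (\<Sum>a<N. A b a * v a) else 0)"

definition model_iso :: "nat \<Rightarrow> metric \<Rightarrow> pt \<Rightarrow> metric \<Rightarrow> pt \<Rightarrow> (nat \<Rightarrow> nat \<Rightarrow> real) \<Rightarrow> nat \<Rightarrow> bool" where
  "model_iso N g P g' Q A l \<longleftrightarrow>
     (\<forall>v\<in>pts N. \<forall>w\<in>pts N. gval N g' Q (lin_map N A v) (lin_map N A w) = gval N g P v w) \<and>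
     (\<forall>i\<le>l. \<forall>vs. length vs = 4 + i \<and> set vs \<subseteq> pts N \<longrightarrow>
        tensor_at (nablaR N g' i) Q (map (lin_map N A) vs) = tensor_at (nablaR N g i) P vs)"

definition curv_homog :: "nat \<Rightarrow> metric \<Rightarrow> nat \<Rightarrow> bool" where
  "curv_homog N g l \<longleftrightarrow> (\<forall>P\<in>pts N. \<forall>Q\<in>pts N. \<exists>A. model_iso N g P g Q A l)"

definition dmap :: "nat \<Rightarrow> (pt \<Rightarrow> pt) \<Rightarrow> pt \<Rightarrow> pt \<Rightarrow> pt" where
  "dmap N \<phi> x v = (\<lambda>b. if b < N then (\<Sum>a<N. pd (\<lambda>y. \<phi> y b) a x * v a) else 0)"

definition loc_isom :: "nat \<Rightarrow> metric \<Rightarrow> pt set \<Rightarrow> pt set \<Rightarrow> (pt \<Rightarrow> pt) \<Rightarrow> bool" where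
  "loc_isom N g U V \<phi> \<longleftrightarrow>
     openin (top_of_set (pts N)) U \<and> openin (top_of_set (pts N)) V \<and>
     bij_betw \<phi> U V \<and>
     (\<forall>b<N. smooth_on N U (\<lambda>x. \<phi> x b)) \<and>
     (\<forall>b<N. smooth_on N V (\<lambda>y. inv_into U \<phi> y b)) \<and>
     (\<forall>x\<in>U. \<forall>v\<in>pts N. \<forall>w\<in>pts N.
        gval N g (\<phi> x) (dmap N \<phi> x v) (dmap N \<phi> x w) = gval N g x v w)"

definition loc_homog :: "nat \<Rightarrow> metric \<Rightarrow> bool" where
  "loc_homog N g \<longleftrightarrow> (\<forall>P\<in>pts N. \<forall>Q\<in>pts N. \<exists>U V \<phi>. P \<in> U \<and> \<phi> P = Q \<and> loc_isom N g U V \<phi>)"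

text \<open>Coordinates: index i (0..k) is u_i, index k+1+j (0..k) is v_j,
  index 2k+1+i (1..k) is s_i.  Dimension 3k+2.  F j is f_j for 1 <= j <= k.\<close>

definition gF :: "nat \<Rightarrow> (nat \<Rightarrow> real) \<Rightarrow> (nat \<Rightarrow> real \<Rightarrow> real) \<Rightarrow> metric" where
  "gF k eps F x a b =
     (if a = 0 \<and> 1 \<le> b \<and> b \<le> k then 2 * F b (x b) * x (2*k+1+b)
      else if b = 0 \<and> 1 \<le> a \<and> a \<le> k then 2 * F a (x a) * x (2*k+1+a)
      else if 1 \<le> a \<and> a \<le> k \<and> a = b then - 2 * x 0 * x (2*k+1+a)
      else if a \<le> k \<and> b = k+1+a then 1
      else if b \<le> k \<and> a = k+1+b then 1
      else if 2*k+2 \<le> a \<and> a \<le> 3*k+1 \<and> a = b then eps (a - (2*k+1))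
      else 0)"

definition admissible :: "nat \<Rightarrow> (nat \<Rightarrow> real \<Rightarrow> real) \<Rightarrow> bool" where
  "admissible k F \<longleftrightarrow> (\<forall>j\<in>{1..k}.
     (\<forall>n u. ((deriv ^^ n) (F j)) differentiable (at u)) \<and>
     (\<forall>u. deriv (F j) u + 1 \<noteq> 0 \<and> (deriv ^^ 2) (F j) u \<noteq> 0))"

definition beta :: "nat \<Rightarrow> (nat \<Rightarrow> real \<Rightarrow> real) \<Rightarrow> nat \<Rightarrow> pt \<Rightarrow> real" where
  "beta l F k x = (\<Sum>j=1..k. (deriv ^^ (l+1)) (F j) (x j) * (1 + deriv (F j) (x j)) ^ (l - 1)
                            / ((deriv ^^ 2) (F j) (x j)) ^ l)"

end

theory Submission
  imports Defs "Jordan_Normal_Form.Determinant"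
begin

text \<open>The forms \<open>du\<^sub>0, \<dots>, du\<^sub>k\<close> are parallel, and \<open>\<nabla>\<^sub>y(du\<^sub>i \<and> ds\<^sub>i)\<close> is a multiple of
  \<open>du\<^sub>i \<and> du\<^sub>0\<close>.  Hence \<open>\<nabla>\<^sup>lR\<close> has a closed form in which, apart from terms that do not see the
  \<open>s\<close>-directions, the only components are \<open>p\<^sub>i\<^sub>,\<^sub>l = \<nabla>\<^sup>lR(u\<^sub>0,u\<^sub>i,u\<^sub>i,s\<^sub>i;u\<^sub>i,\<dots>,u\<^sub>i)\<close> with
  \<open>p\<^sub>i\<^sub>,\<^sub>0 = 1 + f\<^sub>i'\<close> and \<open>p\<^sub>i\<^sub>,\<^sub>l\<close> the derivative of order \<open>l + 1\<close> of \<open>f\<^sub>i\<close>.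

  The null space of \<open>R\<close> is \<open>span(\<partial>\<^sub>v)\<close>, and its orthogonal complement is
  \<open>W = span(\<partial>\<^sub>v, \<partial>\<^sub>s)\<close>.  A vector \<open>y\<close> with \<open>\<nabla>R(\<cdot>,\<cdot>,\<cdot>,w;y) = R(\<cdot>,\<cdot>,\<cdot>,w)\<close> for all \<open>w\<close> in \<open>W\<close>
  has \<open>u\<^sub>i\<close>-components \<open>p\<^sub>i\<^sub>,\<^sub>0 / p\<^sub>i\<^sub>,\<^sub>1\<close>, and \<open>\<nabla>\<^sup>lR(\<cdot>,\<cdot>,\<cdot>,w;y,\<dots>,y) = R(\<cdot>,\<cdot>,\<cdot>,Ow)\<close> defines an
  endomorphism \<open>O\<close> of \<open>W / span(\<partial>\<^sub>v)\<close> which is diagonal in the basis \<open>\<partial>\<^sub>s\<close> and whose trace is \<open>beta l\<close>.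
  An isomorphism of models conjugates one such endomorphism into the other.  Finally, a local
  isometry transforms the Christoffel symbols, hence \<open>R\<close> and all \<open>\<nabla>\<^sup>lR\<close>, tensorially, so its
  differential is an isomorphism of models of every order.\<close>

section \<open>Smooth functions of the coordinates\<close>

definition smooth_fn :: "(real \<Rightarrow> real) \<Rightarrow> bool" where
  "smooth_fn h \<longleftrightarrow> (\<forall>n u. ((deriv ^^ n) h) differentiable (at u))"

lemma smooth_fn_DERIV:
  assumes "smooth_fn h"
  shows "(h has_real_derivative deriv h u) (at u)"
  using assms[unfolded smooth_fn_def, rule_format, of 0 u]
  by (simp add: DERIV_deriv_iff_real_differentiable)

lemma smooth_fn_deriv: "smooth_fn h \<Longrightarrow> smooth_fn (deriv h)"
  unfolding smooth_fn_def by (metis comp_apply funpow_Suc_right)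

text \<open>The property passes to every iterated derivative. Smoothness of sums and products
  follows this way without a formula for their higher derivatives.\<close>

lemma smooth_fn_coinduct:
  assumes "P h" and step: "\<And>h u. P h \<Longrightarrow> h differentiable (at u)" "\<And>h. P h \<Longrightarrow> P (deriv h)"
  shows "smooth_fn h"
proof -
  have "P ((deriv ^^ n) h)" for n
    by (induction n) (auto intro: assms)
  then show ?thesis unfolding smooth_fn_def using step(1) by blast
qed

text \<open>The derivative of a product is a sum of products, so products alone give no invariant
  class. Closing under sums and products does: by the Leibniz rule this class is stable under
  \<open>deriv\<close>, and \<open>smooth_fn_coinduct\<close> applies to it.\<close>

inductive smooth_closure :: "(real \<Rightarrow> real) \<Rightarrow> bool" where
  gen: "smooth_fn h \<Longrightarrow> smooth_closure h"
| const: "smooth_closure (\<lambda>u. c)"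
| ident: "smooth_closure (\<lambda>u. u)"
| add: "smooth_closure h1 \<Longrightarrow> smooth_closure h2 \<Longrightarrow> smooth_closure (\<lambda>u. h1 u + h2 u)"
| mult: "smooth_closure h1 \<Longrightarrow> smooth_closure h2 \<Longrightarrow> smooth_closure (\<lambda>u. h1 u * h2 u)"

lemma smooth_closure_DERIV:
  "smooth_closure h \<Longrightarrow> \<exists>h'. smooth_closure h' \<and> (\<forall>u. (h has_real_derivative h' u) (at u))"
proof (induction rule: smooth_closure.induct)
  case (gen h)
  then show ?case by (meson smooth_closure.gen smooth_fn_DERIV smooth_fn_deriv)
next
  case (const c)
  show ?case by (rule exI[of _ "\<lambda>u. 0"]) (auto intro: smooth_closure.const)
next
  case ident
  show ?case by (rule exI[of _ "\<lambda>u. 1"]) (auto intro: smooth_closure.const)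
next
  case (add h1 h2)
  then obtain d1 d2 where "smooth_closure d1" "smooth_closure d2"
    "\<forall>u. (h1 has_real_derivative d1 u) (at u)" "\<forall>u. (h2 has_real_derivative d2 u) (at u)" by blast
  then show ?case
    by (intro exI[of _ "\<lambda>u. d1 u + d2 u"]) (auto intro: smooth_closure.add DERIV_add)
next
  case (mult h1 h2)
  then obtain d1 d2 where "smooth_closure d1" "smooth_closure d2"
    "\<forall>u. (h1 has_real_derivative d1 u) (at u)" "\<forall>u. (h2 has_real_derivative d2 u) (at u)" by blast
  with mult.hyps show ?case
    by (intro exI[of _ "\<lambda>u. d1 u * h2 u + d2 u * h1 u"])
      (auto intro: smooth_closure.add smooth_closure.mult DERIV_mult)
qed

lemma smooth_closure_smooth_fn: "smooth_closure h \<Longrightarrow> smooth_fn h"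
proof (rule smooth_fn_coinduct[of smooth_closure], assumption)
  fix h and u :: real
  assume "smooth_closure h"
  then show "h differentiable (at u)"
    using smooth_closure_DERIV real_differentiable_def by blast
next
  fix h
  assume "smooth_closure h"
  then obtain h' where h': "smooth_closure h'" "\<forall>u. (h has_real_derivative h' u) (at u)"
    using smooth_closure_DERIV by blast
  then have "deriv h = h'" by (auto intro: DERIV_imp_deriv)
  with h' show "smooth_closure (deriv h)" by simp
qed

lemma smooth_fn_const: "smooth_fn (\<lambda>u. c)"
  and smooth_fn_ident: "smooth_fn (\<lambda>u. u)"
  and smooth_fn_add: "smooth_fn h1 \<Longrightarrow> smooth_fn h2 \<Longrightarrow> smooth_fn (\<lambda>u. h1 u + h2 u)"
  and smooth_fn_mult: "smooth_fn h1 \<Longrightarrow> smooth_fn h2 \<Longrightarrow> smooth_fn (\<lambda>u. h1 u * h2 u)"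
  by (rule smooth_closure_smooth_fn, blast intro: smooth_closure.intros)+

section \<open>Smooth functions of finitely many coordinates\<close>

text \<open>The algebra generated by smooth functions of one coordinate each. It contains the
  coefficients of the metric, of the connection and of the curvature, and calculus on it reduces to
  one variable and the Leibniz rule.\<close>

inductive smooth_alg :: "nat \<Rightarrow> (pt \<Rightarrow> real) \<Rightarrow> bool" for N where
  gen: "j < N \<Longrightarrow> smooth_fn h \<Longrightarrow> smooth_alg N (\<lambda>x. h (x j))"
| const: "smooth_alg N (\<lambda>x. c)"
| add: "smooth_alg N h1 \<Longrightarrow> smooth_alg N h2 \<Longrightarrow> smooth_alg N (\<lambda>x. h1 x + h2 x)"
| mult: "smooth_alg N h1 \<Longrightarrow> smooth_alg N h2 \<Longrightarrow> smooth_alg N (\<lambda>x. h1 x * h2 x)"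

lemma smooth_alg_coord: "j < N \<Longrightarrow> smooth_alg N (\<lambda>x. x j)"
  by (rule smooth_alg.gen[OF _ smooth_fn_ident])

lemma smooth_alg_uminus: "smooth_alg N h \<Longrightarrow> smooth_alg N (\<lambda>x. - h x)"
  using smooth_alg.mult[OF smooth_alg.const[of N "-1"], of h] by simp

lemma smooth_alg_diff: "smooth_alg N h1 \<Longrightarrow> smooth_alg N h2 \<Longrightarrow> smooth_alg N (\<lambda>x. h1 x - h2 x)"
  using smooth_alg.add[OF _ smooth_alg_uminus, of N h1 h2] by simp

lemma smooth_alg_sum: "(\<And>i. i \<in> S \<Longrightarrow> smooth_alg N (h i)) \<Longrightarrow> smooth_alg N (\<lambda>x. \<Sum>i\<in>S. h i x)"
  by (induction S rule: infinite_finite_induct) (auto intro: smooth_alg.intros)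

lemma smooth_alg_prod_list:
  "(\<And>y. y \<in> set ys \<Longrightarrow> smooth_alg N (h y)) \<Longrightarrow> smooth_alg N (\<lambda>x. \<Prod>y\<leftarrow>ys. h y x)"
  by (induction ys) (auto intro: smooth_alg.intros)

lemmas smooth_alg_intros = smooth_alg.const smooth_alg_coord smooth_alg.add smooth_alg.mult smooth_alg_uminus smooth_alg_diff smooth_alg_sum

lemma DERIV_coord_shift:
  "((\<lambda>t. (x(a := x a + t)) j) has_real_derivative (if j = a then 1 else 0)) (at (0::real))"
  for x :: pt
  by (auto intro!: derivative_eq_intros)

lemma smooth_alg_differentiable:
  "smooth_alg N h \<Longrightarrow> (\<lambda>t. h (x(a := x a + t))) differentiable (at (0::real))"
proof (induction rule: smooth_alg.induct)
  case (gen j h)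
  show ?case
    using DERIV_chain2[OF smooth_fn_DERIV[OF gen(2)] DERIV_coord_shift[of x a j]]
    by (auto simp: real_differentiable_def)
qed (auto intro: differentiable_add differentiable_mult)

lemma smooth_alg_pd_DERIV:
  assumes "smooth_alg N h"
  shows "((\<lambda>t. h (x(a := x a + t))) has_real_derivative pd h a x) (at 0)"
  using smooth_alg_differentiable[OF assms, of x a] DERIV_deriv_iff_real_differentiable
  unfolding pd_def by blast

lemma pd_const: "pd (\<lambda>x. c) a = (\<lambda>x. 0)"
  by (simp add: pd_def fun_eq_iff)

lemma pd_gen:
  assumes "smooth_fn h"
  shows "pd (\<lambda>x. h (x j)) a = (\<lambda>x. if j = a then deriv h (x j) else 0)"
proof
  fix x
  show "pd (\<lambda>x. h (x j)) a x = (if j = a then deriv h (x j) else 0)"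
    unfolding pd_def using DERIV_chain2[OF smooth_fn_DERIV[OF assms] DERIV_coord_shift[of x a j]]
    by (auto intro!: DERIV_imp_deriv)
qed

lemma pd_add:
  assumes "smooth_alg N h1" "smooth_alg N h2"
  shows "pd (\<lambda>x. h1 x + h2 x) a = (\<lambda>x. pd h1 a x + pd h2 a x)"
  using DERIV_add[OF assms[THEN smooth_alg_pd_DERIV]]
  by (auto simp: pd_def[of "\<lambda>x. h1 x + h2 x"] fun_eq_iff intro!: DERIV_imp_deriv)

lemma pd_mult:
  assumes "smooth_alg N h1" "smooth_alg N h2"
  shows "pd (\<lambda>x. h1 x * h2 x) a = (\<lambda>x. pd h1 a x * h2 x + h1 x * pd h2 a x)"
proof
  fix x
  show "pd (\<lambda>x. h1 x * h2 x) a x = pd h1 a x * h2 x + h1 x * pd h2 a x"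
    using DERIV_mult[OF assms[THEN smooth_alg_pd_DERIV[where x=x and a=a]]]
    by (auto simp: pd_def[of "\<lambda>x. h1 x * h2 x"] algebra_simps intro!: DERIV_imp_deriv)
qed

lemma smooth_alg_pd: "smooth_alg N h \<Longrightarrow> smooth_alg N (pd h a)"
proof (induction rule: smooth_alg.induct)
  case (gen j h)
  then show ?case
    by (cases "j = a") (auto simp: pd_gen intro: smooth_alg_intros smooth_alg.gen smooth_fn_deriv)
qed (auto simp: pd_const pd_add pd_mult intro: smooth_alg_intros)

text \<open>For a generator both mixed partials vanish unless \<open>a\<close> and \<open>b\<close>
  are its own coordinate. For a product the Leibniz expansion is symmetric once the factors satisfy
  the claim.\<close>

lemma smooth_alg_pd_commute: "smooth_alg N h \<Longrightarrow> pd (pd h a) b = pd (pd h b) a"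
proof (induction rule: smooth_alg.induct)
  case (gen j h)
  show ?case
    by (cases "j = a"; cases "j = b")
      (simp_all add: pd_gen[OF gen(2)] pd_gen[OF smooth_fn_deriv[OF gen(2)]] pd_const)
next
  case (mult h1 h2)
  note n = mult.hyps mult.hyps[THEN smooth_alg_pd]
  have "pd (pd (\<lambda>x. h1 x * h2 x) a) b = (\<lambda>x. (pd (pd h1 a) b x * h2 x + pd h1 a x * pd h2 b x)
      + (pd h1 b x * pd h2 a x + h1 x * pd (pd h2 a) b x))" for a b
    by (simp add: pd_mult[OF n(1,2)] pd_add[OF smooth_alg.mult[OF n(3,2)] smooth_alg.mult[OF n(1,4)]]
        pd_mult[OF n(3,2)] pd_mult[OF n(1,4)])
  then show ?case by (simp add: mult.IH fun_eq_iff)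
next
  case (add h1 h2)
  note n = add.hyps add.hyps[THEN smooth_alg_pd]
  show ?case by (simp add: pd_add[OF n(1,2)] pd_add[OF n(3,4)] add.IH)
qed (simp add: pd_const)

text \<open>A generator sees one coordinate of the curve, so the one-variable chain rule suffices;
  sums and products preserve the formula. Hence the curve need only be differentiable componentwise
  at 0.\<close>

lemma smooth_alg_chain:
  assumes "smooth_alg N h" and c: "\<And>a. a < N \<Longrightarrow> ((\<lambda>t. c t a) has_real_derivative c' a) (at 0)"
  shows "((\<lambda>t. h (c t)) has_real_derivative (\<Sum>a<N. c' a * pd h a (c 0))) (at 0)"
  using assms(1)
proof (induction rule: smooth_alg.induct)
  case (gen j h)
  have "(\<Sum>a<N. c' a * pd (\<lambda>x. h (x j)) a (c 0)) = (\<Sum>a<N. if j = a then c' a * deriv h (c 0 j) else 0)"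
    by (rule sum.cong) (auto simp: pd_gen[OF gen(2)])
  also have "\<dots> = deriv h (c 0 j) * c' j" using gen(1) by simp
  finally show ?case using DERIV_chain2[OF smooth_fn_DERIV[OF gen(2)] c[OF gen(1)]] by simp
next
  case (const z)
  show ?case by (simp add: pd_const)
next
  case (add h1 h2)
  show ?case using DERIV_add[OF add.IH]
    by (simp add: pd_add[OF add.hyps] distrib_left sum.distrib)
next
  case (mult h1 h2)
  have "((\<lambda>t. h1 (c t) * h2 (c t)) has_real_derivative
     (\<Sum>a<N. c' a * pd h1 a (c 0)) * h2 (c 0) + (\<Sum>a<N. c' a * pd h2 a (c 0)) * h1 (c 0)) (at 0)"
    by (rule DERIV_mult[OF mult.IH])
  also have "(\<Sum>a<N. c' a * pd h1 a (c 0)) * h2 (c 0) + (\<Sum>a<N. c' a * pd h2 a (c 0)) * h1 (c 0)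
     = (\<Sum>a<N. c' a * pd (\<lambda>x. h1 x * h2 x) a (c 0))"
    by (simp add: pd_mult[OF mult.hyps] sum_distrib_right sum.distrib distrib_left)
       (simp add: mult_ac)
  finally show ?case .
qed

text \<open>Turns a sum of partial derivatives into an ordinary derivative along the line with
  velocity \<open>X x\<close>; derivatives of tensors along fields are computed on this
  line.\<close>

lemma ddir_DERIV:
  assumes "smooth_alg N h"
  shows "((\<lambda>t. h (\<lambda>m. x m + t * X x m)) has_real_derivative ddir N X h x) (at 0)"
proof -
  have "((\<lambda>t. x a + t * X x a) has_real_derivative X x a) (at 0)" for a
    by (auto intro!: derivative_eq_intros)
  then show ?thesis
    using smooth_alg_chain[OF assms, of "\<lambda>t m. x m + t * X x m" "X x"] by (simp add: ddir_def)
qed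

definition smooth_field :: "nat \<Rightarrow> vfield \<Rightarrow> bool" where
  "smooth_field N X \<longleftrightarrow> (\<forall>m<N. smooth_alg N (\<lambda>x. X x m))"

lemma smooth_alg_ddir: "smooth_field N X \<Longrightarrow> smooth_alg N h \<Longrightarrow> smooth_alg N (\<lambda>x. ddir N X h x)"
  unfolding ddir_def smooth_field_def by (intro smooth_alg_sum smooth_alg.mult smooth_alg_pd) auto

lemma ddir_commutator:
  assumes X: "smooth_field N X" and Y: "smooth_field N Y" and h: "smooth_alg N h"
  shows "ddir N X (ddir N Y h) x - ddir N Y (ddir N X h) x = ddir N (lie N X Y) h x"
proof -
  have pd_sum: "pd (\<lambda>x. \<Sum>i\<in>S. q i x) a x = (\<Sum>i\<in>S. pd (q i) a x)"
    if "finite S" "\<And>i. i \<in> S \<Longrightarrow> smooth_alg N (q i)" for S :: "nat set" and q a x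
    using that
  proof (induction S rule: finite_induct)
    case (insert i S)
    then show ?case using pd_add[OF _ smooth_alg_sum[of S N q], of "q i" a] by auto
  qed (simp add: pd_const)
  have exp: "ddir N X (ddir N Y h) x =
     (\<Sum>a<N. \<Sum>b<N. X x a * (pd (\<lambda>y. Y y b) a x * pd h b x))
     + (\<Sum>a<N. \<Sum>b<N. X x a * (Y x b * pd (pd h b) a x))"
    if "smooth_field N X" "smooth_field N Y" for X Y
  proof -
    have "pd (ddir N Y h) a x = (\<Sum>b<N. pd (\<lambda>y. Y y b) a x * pd h b x + Y x b * pd (pd h b) a x)" for a
    proof -
      have "pd (ddir N Y h) a x = pd (\<lambda>x. \<Sum>b<N. Y x b * pd h b x) a x"
        by (simp add: ddir_def[abs_def])
      also have "\<dots> = (\<Sum>b<N. pd (\<lambda>x. Y x b * pd h b x) a x)"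
        using that by (intro pd_sum smooth_alg.mult smooth_alg_pd h) (auto simp: smooth_field_def)
      also have "\<dots> = (\<Sum>b<N. pd (\<lambda>y. Y y b) a x * pd h b x + Y x b * pd (pd h b) a x)"
        using that by (intro sum.cong) (auto simp: smooth_field_def pd_mult[OF _ smooth_alg_pd[OF h]])
      finally show ?thesis .
    qed
    then show ?thesis
      by (simp add: ddir_def[of N X] sum_distrib_left sum.distrib distrib_left)
  qed
  \<comment> \<open>The second-order parts of the two products agree by the symmetry of mixed
    partials; the first-order parts make up the bracket.\<close>
  have "(\<Sum>a<N. \<Sum>b<N. X x a * (Y x b * pd (pd h b) a x)) = (\<Sum>a<N. \<Sum>b<N. Y x a * (X x b * pd (pd h b) a x))"
    by (subst sum.swap) (auto intro!: sum.cong simp: smooth_alg_pd_commute[OF h] mult_ac)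
  moreover have "(\<Sum>a<N. \<Sum>b<N. X x a * (pd (\<lambda>y. Y y b) a x * pd h b x))
      - (\<Sum>a<N. \<Sum>b<N. Y x a * (pd (\<lambda>y. X y b) a x * pd h b x)) = ddir N (lie N X Y) h x"
    by (subst (1 2) sum.swap)
      (simp add: ddir_def lie_def sum_distrib_right sum_subtractf left_diff_distrib mult.assoc)
  ultimately show ?thesis using exp[OF X Y] exp[OF Y X] by simp
qed

section \<open>The metric and its Christoffel symbols\<close>

locale plane_wave =
  fixes k :: nat and eps :: "nat \<Rightarrow> real" and F :: "nat \<Rightarrow> real \<Rightarrow> real"
  assumes eps_pm: "i \<in> {1..k} \<Longrightarrow> eps i = 1 \<or> eps i = -1"
    and adm: "admissible k F"
begin

section \<open>Coordinate blocks, lowering and raising of indices\<close>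

definition "N = 3 * k + 2"
definition "I = {1..k}"
abbreviation "g \<equiv> gF k eps F"
abbreviation "f1 i \<equiv> deriv (F i)"
abbreviation "f2 i \<equiv> deriv (deriv (F i))"

definition vx :: "nat \<Rightarrow> nat" where "vx j = k + 1 + j"
definition sx :: "nat \<Rightarrow> nat" where "sx i = 2 * k + 1 + i"

lemma finite_I [simp]: "finite I"
  by (simp add: I_def)

lemma eps_sq: "i \<in> I \<Longrightarrow> eps i * eps i = 1"
  using eps_pm by (fastforce simp: I_def)

lemma smooth_F: "i \<in> I \<Longrightarrow> smooth_fn (F i)"
  and f1_nz: "i \<in> I \<Longrightarrow> 1 + f1 i u \<noteq> 0"
  and f2_nz: "i \<in> I \<Longrightarrow> f2 i u \<noteq> 0"
  using adm by (auto simp: I_def admissible_def smooth_fn_def numeral_2_eq_2 add.commute)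

lemma F_DERIV: "i \<in> I \<Longrightarrow> (F i has_real_derivative f1 i u) (at u)"
  and f1_DERIV: "i \<in> I \<Longrightarrow> (f1 i has_real_derivative f2 i u) (at u)"
  by (blast intro: smooth_fn_DERIV smooth_F smooth_fn_deriv)+

lemma idx_less [simp]: "0 < N" "i \<in> I \<Longrightarrow> i < N" "j \<le> k \<Longrightarrow> vx j < N" "i \<in> I \<Longrightarrow> vx i < N" "i \<in> I \<Longrightarrow> sx i < N"
  by (auto simp: vx_def sx_def N_def I_def)

lemma vx0_less [simp]: "vx 0 < N" by simp

lemma idx_neq [simp]:
  "vx j \<noteq> 0" "sx j \<noteq> 0" "0 \<noteq> vx j" "0 \<noteq> sx j"
  "i \<in> I \<Longrightarrow> i \<noteq> vx j" "i \<in> I \<Longrightarrow> vx j \<noteq> i" "i \<in> I \<Longrightarrow> i \<noteq> sx j" "i \<in> I \<Longrightarrow> sx j \<noteq> i"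
  "i \<in> I \<Longrightarrow> j \<in> I \<Longrightarrow> vx i \<noteq> sx j" "i \<in> I \<Longrightarrow> j \<in> I \<Longrightarrow> sx j \<noteq> vx i"
  "j \<in> I \<Longrightarrow> vx 0 \<noteq> sx j" "j \<in> I \<Longrightarrow> sx j \<noteq> vx 0"
  "i \<in> I \<Longrightarrow> i \<noteq> 0" "i \<in> I \<Longrightarrow> 0 \<noteq> i"
  "vx j \<notin> I" "sx j \<notin> I" "0 \<notin> I"
  "vx i = vx j \<longleftrightarrow> i = j" "sx i = sx j \<longleftrightarrow> i = j"
  by (auto simp: vx_def sx_def N_def I_def)

lemma idx_cases [consumes 1, case_names u0 u v0 v s]:
  assumes "a < N"
  obtains "a = 0" | i where "i \<in> I" "a = i" | "a = vx 0" | i where "i \<in> I" "a = vx i"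
    | i where "i \<in> I" "a = sx i"
proof -
  consider "a = 0" | "a \<in> I" | "a = vx 0" | "a - (k+1) \<in> I" "a = vx (a - (k+1))"
    | "a - (2*k+1) \<in> I" "a = sx (a - (2*k+1))"
    using assms unfolding vx_def sx_def N_def I_def by force
  then show ?thesis using that by cases auto
qed

lemma sum_idx:
  "(\<Sum>a<N. h a) = h 0 + (\<Sum>i\<in>I. h i) + h (vx 0) + (\<Sum>i\<in>I. h (vx i)) + (\<Sum>i\<in>I. h (sx i))"
  for h :: "nat \<Rightarrow> real"
proof -
  have *: "{..<N} = insert 0 (insert (vx 0) (I \<union> (vx ` I \<union> sx ` I)))"
    by (auto elim: idx_cases)
  have "inj_on vx I" "inj_on sx I" by (auto simp: inj_on_def)
  moreover have "I \<inter> (vx ` I \<union> sx ` I) = {}" "vx ` I \<inter> sx ` I = {}"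
    "vx 0 \<notin> I \<union> (vx ` I \<union> sx ` I)" "0 \<notin> insert (vx 0) (I \<union> (vx ` I \<union> sx ` I))"
    by auto
  ultimately show ?thesis
    unfolding * by (simp add: sum.union_disjoint sum.reindex)
qed

lemma g_simps [simp]:
  "g x 0 0 = 0"
  "i \<in> I \<Longrightarrow> g x 0 i = 2 * F i (x i) * x (sx i)"
  "i \<in> I \<Longrightarrow> g x i 0 = 2 * F i (x i) * x (sx i)"
  "i \<in> I \<Longrightarrow> j \<in> I \<Longrightarrow> g x i j = (if i = j then - 2 * x 0 * x (sx i) else 0)"
  "g x 0 (vx j) = (if j = 0 then 1 else 0)"
  "g x (vx j) 0 = (if j = 0 then 1 else 0)"
  "i \<in> I \<Longrightarrow> g x i (vx j) = (if i = j then 1 else 0)"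
  "i \<in> I \<Longrightarrow> g x (vx j) i = (if i = j then 1 else 0)"
  "i \<in> I \<Longrightarrow> j \<in> I \<Longrightarrow> g x (vx i) (vx j) = 0" "i \<in> I \<Longrightarrow> g x (vx i) (vx 0) = 0" 
  "i \<in> I \<Longrightarrow> g x (vx 0) (vx i) = 0"  "g x (vx 0) (vx 0) = 0"
  "i \<in> I \<Longrightarrow> g x 0 (sx i) = 0" "i \<in> I \<Longrightarrow> g x (sx i) 0 = 0"
  "i \<in> I \<Longrightarrow> j \<in> I \<Longrightarrow> g x j (sx i) = 0" "i \<in> I \<Longrightarrow> j \<in> I \<Longrightarrow> g x (sx i) j = 0"
  "i \<in> I \<Longrightarrow> g x (vx 0) (sx i) = 0" "i \<in> I \<Longrightarrow> g x (sx i) (vx 0) = 0"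
  "i \<in> I \<Longrightarrow> j \<in> I \<Longrightarrow> g x (vx j) (sx i) = 0" "i \<in> I \<Longrightarrow> j \<in> I \<Longrightarrow> g x (sx i) (vx j) = 0"
  "i \<in> I \<Longrightarrow> j \<in> I \<Longrightarrow> g x (sx i) (sx j) = (if i = j then eps i else 0)"
  by (auto simp: gF_def vx_def sx_def I_def)

lemma g_sym: "g x a b = g x b a"
  by (auto simp: gF_def)

definition lower :: "pt \<Rightarrow> pt \<Rightarrow> nat \<Rightarrow> real" where
  "lower x w a = (\<Sum>b<N. g x a b * w b)"

lemma lower_simps [simp]:
  "lower x w 0 = (\<Sum>i\<in>I. 2 * F i (x i) * x (sx i) * w i) + w (vx 0)"
  "i \<in> I \<Longrightarrow> lower x w i = 2 * F i (x i) * x (sx i) * w 0 - 2 * x 0 * x (sx i) * w i + w (vx i)"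
  "lower x w (vx 0) = w 0"
  "i \<in> I \<Longrightarrow> lower x w (vx i) = w i"
  "i \<in> I \<Longrightarrow> lower x w (sx i) = eps i * w (sx i)"
  by (simp_all add: lower_def sum_idx if_distrib[of "\<lambda>z. z * _"] cong: if_cong)

text \<open>The linear system is triangular: the \<open>v\<close>-rows return the
  \<open>u\<close>-components of \<open>w\<close>, then the \<open>u\<close>-rows return the
  \<open>v\<close>-components, and each \<open>s\<close>-row multiplies by a sign.\<close>

lemma lower_inj:
  assumes "\<And>a. a < N \<Longrightarrow> lower x w a = lower x w' a" and a: "a < N"
  shows "w a = w' a"
proof -
  have 0: "w 0 = w' 0" using assms(1)[of "vx 0"] by simp
  have u: "w i = w' i" if "i \<in> I" for i using assms(1)[of "vx i"] that by simp
  have v0: "w (vx 0) = w' (vx 0)" using assms(1)[of 0] u by simp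
  have v: "w (vx i) = w' (vx i)" if "i \<in> I" for i using assms(1)[of i] that u 0 by simp
  have s: "w (sx i) = w' (sx i)" if "i \<in> I" for i
    using assms(1)[of "sx i"] that eps_sq[of i] by auto
  show ?thesis using a by (cases rule: idx_cases) (auto simp: 0 u v0 v s)
qed

definition mkvec :: "(nat \<Rightarrow> real) \<Rightarrow> (nat \<Rightarrow> real) \<Rightarrow> (nat \<Rightarrow> real) \<Rightarrow> pt" where
  "mkvec a b c e = (if e \<le> k then a e else if e \<le> 2 * k + 1 then b (e - (k + 1))
     else if e < N then c (e - (2 * k + 1)) else 0)"

lemma mkvec_simps [simp]:
  "mkvec a b c 0 = a 0" "i \<in> I \<Longrightarrow> mkvec a b c i = a i" "mkvec a b c (vx 0) = b 0"
  "i \<in> I \<Longrightarrow> mkvec a b c (vx i) = b i" "i \<in> I \<Longrightarrow> mkvec a b c (sx i) = c i"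
  "N \<le> e \<Longrightarrow> mkvec a b c e = 0"
  by (auto simp: mkvec_def vx_def sx_def I_def N_def)

text \<open>Back substitution in the triangular system of \<open>lower_inj\<close>; each
  \<open>eps i\<close> is its own inverse.\<close>

definition raise :: "pt \<Rightarrow> (nat \<Rightarrow> real) \<Rightarrow> pt" where
  "raise x l = mkvec (\<lambda>j. l (vx j))
     (\<lambda>j. if j = 0 then l 0 - (\<Sum>i\<in>I. 2 * F i (x i) * x (sx i) * l (vx i))
       else l j - 2 * F j (x j) * x (sx j) * l (vx 0) + 2 * x 0 * x (sx j) * l (vx j))
     (\<lambda>i. eps i * l (sx i))"

lemma lower_raise: "a < N \<Longrightarrow> lower x (raise x l) a = l a"
  by (cases rule: idx_cases) (auto simp: raise_def mult.assoc[symmetric] eps_sq)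

lemma raise_ge: "N \<le> e \<Longrightarrow> raise x l e = 0"
  by (simp add: raise_def)

text \<open>\<open>ginv\<close> is a definite description, so existence and uniqueness are both due.
  The columns of the inverse are the raised unit covectors; uniqueness comes from
  \<open>lower_inj\<close> inside the index range and from the prescribed zeros outside.\<close>

lemma ginv_inverse:
  assumes "a < N" "c < N"
  shows "(\<Sum>b<N. g x a b * ginv N g x b c) = (if a = c then 1 else 0)"
proof -
  let ?P = "\<lambda>h. (\<forall>a c. (N \<le> a \<or> N \<le> c) \<longrightarrow> h a c = (0::real)) \<and>
       (\<forall>a<N. \<forall>c<N. (\<Sum>b<N. g x a b * h b c) = (if a = c then 1 else 0))"
  let ?H = "\<lambda>b c. if c < N then raise x (\<lambda>a. if a = c then 1 else 0) b else 0"
  have H: "?P ?H"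
    using lower_raise by (auto simp: lower_def raise_ge)
  have uniq: "h = ?H" if h: "?P h" for h
  proof (intro ext)
    fix b c
    show "h b c = ?H b c"
    proof (cases "b < N \<and> c < N")
      case True
      then show ?thesis
        using lower_inj[of x "\<lambda>b. h b c" "\<lambda>b. ?H b c" b] h H by (simp add: lower_def)
    next
      case False
      then show ?thesis using h by (auto simp: raise_ge)
    qed
  qed
  have "?P (THE h. ?P h)"
    by (rule theI[where P = ?P, OF H]) (rule uniq)
  then have "?P (ginv N g x)"
    by (simp only: ginv_def)
  then show ?thesis using assms by blast
qed

lemma gval_lower: "gval N g x v w = (\<Sum>a<N. v a * lower x w a)"
  by (simp add: gval_def lower_def sum_distrib_left mult_ac)

lemma gval_eq:
  "gval N g x v w = (\<Sum>i\<in>I. 2 * F i (x i) * x (sx i) * (v 0 * w i + v i * w 0)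
       - 2 * x 0 * x (sx i) * v i * w i + v i * w (vx i) + v (vx i) * w i
       + eps i * v (sx i) * w (sx i)) + v 0 * w (vx 0) + v (vx 0) * w 0"
  by (simp add: gval_lower sum_idx sum.distrib sum_subtractf sum_distrib_left algebra_simps)

lemma gval_sym: "gval N g x v w = gval N g x w v"
  by (simp add: gval_eq algebra_simps)

lemma gval_nondeg:
  assumes "\<And>w. w \<in> pts N \<Longrightarrow> gval N g x v w = gval N g x v' w" "a < N"
  shows "v a = v' a"
proof (rule lower_inj[OF _ assms(2)])
  fix a assume a: "a < N"
  let ?e = "\<lambda>b. if b = a then 1 else (0::real)"
  have "gval N g x ?e w = lower x w a" for w
    using a by (simp add: gval_lower if_distrib[of "\<lambda>z. z * _"] cong: if_cong)
  then show "lower x v a = lower x v' a"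
    using assms(1)[of ?e] a by (simp add: pts_def gval_sym[of x _ ?e])
qed

section \<open>Christoffel symbols and the Koszul formula\<close>

text \<open>The derivative of the metric coefficients at \<open>x\<close> in direction
  \<open>u\<close>, contracted with \<open>v\<close> and \<open>w\<close>.\<close>

definition dmetric :: "pt \<Rightarrow> pt \<Rightarrow> pt \<Rightarrow> pt \<Rightarrow> real" where
  "dmetric x u v w = (\<Sum>i\<in>I. 2 * (f1 i (x i) * u i * x (sx i) + F i (x i) * u (sx i)) * (v 0 * w i + v i * w 0)
       - 2 * (u 0 * x (sx i) + x 0 * u (sx i)) * v i * w i)"

lemma gval_DERIV:
  assumes c: "\<And>a. a < N \<Longrightarrow> ((\<lambda>t. c t a) has_real_derivative c' a) (at 0)"
    and v: "\<And>a. a < N \<Longrightarrow> ((\<lambda>t. v t a) has_real_derivative v' a) (at 0)"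
    and w: "\<And>a. a < N \<Longrightarrow> ((\<lambda>t. w t a) has_real_derivative w' a) (at 0)"
  shows "((\<lambda>t. gval N g (c t) (v t) (w t)) has_real_derivative
     dmetric (c 0) c' (v 0) (w 0) + gval N g (c 0) v' (w 0) + gval N g (c 0) (v 0) w') (at 0)"
proof -
  have FD: "((\<lambda>t. F i (c t i)) has_real_derivative f1 i (c 0 i) * c' i) (at 0)"
    "((\<lambda>t. f1 i (c t i)) has_real_derivative f2 i (c 0 i) * c' i) (at 0)" if "i \<in> I" for i
    using DERIV_chain2[OF F_DERIV c] DERIV_chain2[OF f1_DERIV c] that by auto
  note cv = c v w FD
  have "((\<lambda>t. 2 * F i (c t i) * c t (sx i) * (v t 0 * w t i + v t i * w t 0)
       - 2 * c t 0 * c t (sx i) * v t i * w t i + v t i * w t (vx i) + v t (vx i) * w t i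
       + eps i * v t (sx i) * w t (sx i)) has_real_derivative
     (2 * (f1 i (c 0 i) * c' i * c 0 (sx i) + F i (c 0 i) * c' (sx i)) * (v 0 0 * w 0 i + v 0 i * w 0 0)
       - 2 * (c' 0 * c 0 (sx i) + c 0 0 * c' (sx i)) * v 0 i * w 0 i)
     + (2 * F i (c 0 i) * c 0 (sx i) * (v' 0 * w 0 i + v' i * w 0 0)
       - 2 * c 0 0 * c 0 (sx i) * v' i * w 0 i + v' i * w 0 (vx i) + v' (vx i) * w 0 i
       + eps i * v' (sx i) * w 0 (sx i))
     + (2 * F i (c 0 i) * c 0 (sx i) * (v 0 0 * w' i + v 0 i * w' 0)
       - 2 * c 0 0 * c 0 (sx i) * v 0 i * w' i + v 0 i * w' (vx i) + v 0 (vx i) * w' i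
       + eps i * v 0 (sx i) * w' (sx i))) (at 0)" if i: "i \<in> I" for i
    using i by (auto intro!: derivative_eq_intros cv simp: algebra_simps)
  note * = DERIV_sum[of I, OF this, of "\<lambda>n. n"]
  have "((\<lambda>t. v t 0 * w t (vx 0) + v t (vx 0) * w t 0) has_real_derivative
     (v' 0 * w 0 (vx 0) + v' (vx 0) * w 0 0) + (v 0 0 * w' (vx 0) + v 0 (vx 0) * w' 0)) (at 0)"
    by (auto intro!: derivative_eq_intros cv simp: algebra_simps)
  from DERIV_add[OF *  this] show ?thesis
    by (simp add: gval_eq dmetric_def sum.distrib add_ac)
qed

text \<open>The Christoffel symbols as a vector-valued bilinear map, obtained by solving the Koszul
  equation. The vanishing \<open>u\<close>-block says that all forms \<open>du_j\<close> are
  parallel.\<close>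

definition christ :: "pt \<Rightarrow> pt \<Rightarrow> pt \<Rightarrow> pt" where
  "christ x v w = mkvec (\<lambda>j. 0)
     (\<lambda>j. if j = 0 then (\<Sum>i\<in>I. (2 * f1 i (x i) + 1) * x (sx i) * v i * w i
            + F i (x i) * (v i * w (sx i) + v (sx i) * w i))
       else - x (sx j) * (v 0 * w j + v j * w 0) + F j (x j) * (v 0 * w (sx j) + v (sx j) * w 0)
            - x 0 * (v j * w (sx j) + v (sx j) * w j))
     (\<lambda>i. eps i * (x 0 * v i * w i - F i (x i) * (v 0 * w i + v i * w 0)))"

text \<open>The derivative of \<open>christ\<close> in the base point, in direction
  \<open>u\<close>, with \<open>v\<close> and \<open>w\<close> held fixed.\<close>

definition dchrist :: "pt \<Rightarrow> pt \<Rightarrow> pt \<Rightarrow> pt \<Rightarrow> pt" where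
  "dchrist x u v w = mkvec (\<lambda>j. 0)
     (\<lambda>j. if j = 0 then (\<Sum>i\<in>I. (2 * f2 i (x i) * u i * x (sx i) + (2 * f1 i (x i) + 1) * u (sx i)) * v i * w i
            + f1 i (x i) * u i * (v i * w (sx i) + v (sx i) * w i))
       else - u (sx j) * (v 0 * w j + v j * w 0) + f1 j (x j) * u j * (v 0 * w (sx j) + v (sx j) * w 0)
            - u 0 * (v j * w (sx j) + v (sx j) * w j))
     (\<lambda>i. eps i * (u 0 * v i * w i - f1 i (x i) * u i * (v 0 * w i + v i * w 0)))"

lemma christ_simps [simp]:
  "christ x v w 0 = 0" "i \<in> I \<Longrightarrow> christ x v w i = 0" "N \<le> e \<Longrightarrow> christ x v w e = 0"
  "i \<in> I \<Longrightarrow> christ x v w (sx i) = eps i * (x 0 * v i * w i - F i (x i) * (v 0 * w i + v i * w 0))"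
  by (simp_all add: christ_def)

lemma christ_pts: "christ x v w \<in> pts N"
  by (simp add: pts_def)

lemma christ_sym: "christ x v w = christ x w v"
  unfolding christ_def by (intro arg_cong2[of _ _ _ _ "mkvec _"] ext) (simp_all add: algebra_simps)

lemma christ_DERIV:
  assumes c: "\<And>a. a < N \<Longrightarrow> ((\<lambda>t. c t a) has_real_derivative c' a) (at 0)"
    and v: "\<And>a. a < N \<Longrightarrow> ((\<lambda>t. v t a) has_real_derivative v' a) (at 0)"
    and w: "\<And>a. a < N \<Longrightarrow> ((\<lambda>t. w t a) has_real_derivative w' a) (at 0)"
    and e: "e < N"
  shows "((\<lambda>t. christ (c t) (v t) (w t) e) has_real_derivative
     dchrist (c 0) c' (v 0) (w 0) e + christ (c 0) v' (w 0) e + christ (c 0) (v 0) w' e) (at 0)"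
proof -
  have FD: "((\<lambda>t. F i (c t i)) has_real_derivative f1 i (c 0 i) * c' i) (at 0)"
    "((\<lambda>t. f1 i (c t i)) has_real_derivative f2 i (c 0 i) * c' i) (at 0)" if "i \<in> I" for i
    using DERIV_chain2[OF F_DERIV c] DERIV_chain2[OF f1_DERIV c] that by auto
  note cv = c v w FD
  show ?thesis using e
  proof (cases rule: idx_cases)
    case v0
    have "((\<lambda>t. (2 * f1 i (c t i) + 1) * c t (sx i) * v t i * w t i
            + F i (c t i) * (v t i * w t (sx i) + v t (sx i) * w t i)) has_real_derivative
      ((2 * f2 i (c 0 i) * c' i * c 0 (sx i) + (2 * f1 i (c 0 i) + 1) * c' (sx i)) * v 0 i * w 0 i
            + f1 i (c 0 i) * c' i * (v 0 i * w 0 (sx i) + v 0 (sx i) * w 0 i))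
      + ((2 * f1 i (c 0 i) + 1) * c 0 (sx i) * v' i * w 0 i
            + F i (c 0 i) * (v' i * w 0 (sx i) + v' (sx i) * w 0 i))
      + ((2 * f1 i (c 0 i) + 1) * c 0 (sx i) * v 0 i * w' i
            + F i (c 0 i) * (v 0 i * w' (sx i) + v 0 (sx i) * w' i))) (at 0)" if i: "i \<in> I" for i
      using i by (auto intro!: derivative_eq_intros cv simp: algebra_simps)
    from DERIV_sum[of I, OF this] v0 show ?thesis
      by (simp add: christ_def dchrist_def sum.distrib)
  next
    case (v i)
    then show ?thesis unfolding christ_def dchrist_def
      by (auto intro!: derivative_eq_intros cv simp: algebra_simps)
  next
    case (s i)
    then show ?thesis unfolding christ_def dchrist_def
      by (auto intro!: derivative_eq_intros cv simp: algebra_simps)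
  qed (auto simp: christ_def dchrist_def)
qed

text \<open>Characterizes \<open>christ\<close> by the metric alone. This identifies it with
  \<open>chr\<close> and later yields its transformation law under local isometries.\<close>

lemma koszul: "2 * gval N g x (christ x u v) w = dmetric x u v w + dmetric x v u w - dmetric x w u v"
proof -
  have "2 * gval N g x (christ x u v) w = (\<Sum>i\<in>I. 2 * christ x u v (vx i) * w i + 2 * eps i * christ x u v (sx i) * w (sx i))
     + 2 * christ x u v (vx 0) * w 0"
    by (simp add: gval_eq sum_distrib_left algebra_simps)
  \<comment> \<open>The \<open>vx 0\<close> component is itself a sum over \<open>I\<close>; merged
    with the other terms, it allows a comparison for each \<open>i\<close> separately.\<close>
  also have "\<dots> = (\<Sum>i\<in>I. 2 * christ x u v (vx i) * w i + 2 * eps i * christ x u v (sx i) * w (sx i)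
      + 2 * ((2 * f1 i (x i) + 1) * x (sx i) * u i * v i
            + F i (x i) * (u i * v (sx i) + u (sx i) * v i)) * w 0)"
    unfolding sum.distrib[of _ _ I]
    by (simp add: christ_def sum_distrib_left sum_distrib_right)
  also have "\<dots> = dmetric x u v w + dmetric x v u w - dmetric x w u v"
    unfolding dmetric_def sum.distrib[symmetric] sum_subtractf[symmetric]
  proof (rule sum.cong)
    fix i assume i: "i \<in> I"
    have "2 * eps i * christ x u v (sx i) * w (sx i)
       = 2 * (eps i * eps i) * (x 0 * u i * v i - F i (x i) * (u 0 * v i + u i * v 0)) * w (sx i)"
      using i by simp
    then have s: "2 * eps i * christ x u v (sx i) * w (sx i)
       = 2 * (x 0 * u i * v i - F i (x i) * (u 0 * v i + u i * v 0)) * w (sx i)"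
      by (simp only: eps_sq[OF i] mult_1_right)
    have v: "christ x u v (vx i) = - x (sx i) * (u 0 * v i + u i * v 0) + F i (x i) * (u 0 * v (sx i) + u (sx i) * v 0)
            - x 0 * (u i * v (sx i) + u (sx i) * v i)"
      using i by (auto simp: christ_def)
    show "2 * christ x u v (vx i) * w i + 2 * eps i * christ x u v (sx i) * w (sx i)
      + 2 * ((2 * f1 i (x i) + 1) * x (sx i) * u i * v i
            + F i (x i) * (u i * v (sx i) + u (sx i) * v i)) * w 0 =
      2 * (f1 i (x i) * u i * x (sx i) + F i (x i) * u (sx i)) * (v 0 * w i + v i * w 0)
       - 2 * (u 0 * x (sx i) + x 0 * u (sx i)) * v i * w i +
      (2 * (f1 i (x i) * v i * x (sx i) + F i (x i) * v (sx i)) * (u 0 * w i + u i * w 0)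
       - 2 * (v 0 * x (sx i) + x 0 * v (sx i)) * u i * w i) -
      (2 * (f1 i (x i) * w i * x (sx i) + F i (x i) * w (sx i)) * (u 0 * v i + u i * v 0)
       - 2 * (w 0 * x (sx i) + x 0 * w (sx i)) * u i * v i)"
      unfolding s v by (simp add: algebra_simps)
  qed simp
  finally show ?thesis .
qed

end

context plane_wave
begin

section \<open>The connection and the curvature operator\<close>

definition ev :: "nat \<Rightarrow> pt" where
  "ev a = (\<lambda>m. if m = a then 1 else 0)"

lemma ev_pts: "a < N \<Longrightarrow> ev a \<in> pts N"
  by (auto simp: ev_def pts_def)

lemma gval_ev: "a < N \<Longrightarrow> gval N g x v (ev a) = lower x v a"
  by (subst gval_sym) (simp add: gval_lower ev_def if_distrib[of "\<lambda>z. z * _"] cong: if_cong)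

lemma lower_ev: "b < N \<Longrightarrow> lower x (ev b) a = g x a b"
  by (simp add: lower_def ev_def if_distrib[of "\<lambda>z. _ * z"] cong: if_cong)

lemma pd_g:
  assumes "a < N" "b < N" "c < N"
  shows "pd (\<lambda>y. g y b c) a x = dmetric x (ev a) (ev b) (ev c)"
proof -
  have eq: "g y b c = gval N g y (ev b) (ev c)" for y
    using assms by (simp add: gval_ev lower_ev g_sym)
  have "((\<lambda>t. gval N g (x(a := x a + t)) (ev b) (ev c)) has_real_derivative
     dmetric (x(a := x a + 0)) (ev a) (ev b) (ev c) + gval N g (x(a := x a + 0)) (\<lambda>_. 0) (ev c)
       + gval N g (x(a := x a + 0)) (ev b) (\<lambda>_. 0)) (at 0)"
    by (rule gval_DERIV) (use DERIV_coord_shift[of x a] in \<open>auto simp: ev_def\<close>)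
  then show ?thesis
    unfolding pd_def eq by (intro DERIV_imp_deriv) (simp add: gval_def)
qed

text \<open>After lowering the index, \<open>ginv\<close> cancels against the metric and the symbols
  of the first kind remain, which are the Koszul expression on coordinate vectors.\<close>

lemma chr_eq:
  assumes "e < N" "a < N" "b < N"
  shows "chr N g e a b x = christ x (ev a) (ev b) e"
proof (rule lower_inj[OF _ assms(1), of x "\<lambda>e. chr N g e a b x"])
  fix c assume c: "c < N"
  have "lower x (\<lambda>e. chr N g e a b x) c
      = (\<Sum>d<N. (\<Sum>e<N. g x c e * ginv N g x e d) * chr1 g a b d x)"
    unfolding lower_def chr_def sum_distrib_left sum_distrib_right
    by (subst sum.swap) (simp add: mult.assoc)
  also have "\<dots> = chr1 g a b c x"
    using c by (simp add: ginv_inverse if_distrib[of "\<lambda>z. z * _"] cong: if_cong)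
  also have "\<dots> = gval N g x (christ x (ev a) (ev b)) (ev c)"
    using koszul[of x "ev a" "ev b" "ev c"] assms c by (simp add: chr1_def pd_g)
  finally show "lower x (\<lambda>e. chr N g e a b x) c = lower x (christ x (ev a) (ev b)) c"
    using c by (simp add: gval_ev)
qed

lemma mkvec_lin:
  "mkvec a b c e + z * mkvec a' b' c' e
    = mkvec (\<lambda>j. a j + z * a' j) (\<lambda>j. b j + z * b' j) (\<lambda>j. c j + z * c' j) e"
  by (simp add: mkvec_def)

lemma mkvec_cong:
  assumes "a 0 = a' 0" "\<And>i. i \<in> I \<Longrightarrow> a i = a' i" "b 0 = b' 0" "\<And>i. i \<in> I \<Longrightarrow> b i = b' i"
    "\<And>i. i \<in> I \<Longrightarrow> c i = c' i"
  shows "mkvec a b c = mkvec a' b' c'"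
proof
  fix e
  show "mkvec a b c e = mkvec a' b' c' e"
  proof (cases "e < N")
    case True
    then show ?thesis by (cases rule: idx_cases) (simp_all add: assms)
  qed simp
qed

text \<open>The form \<open>v + z * v'\<close> covers additivity and homogeneity at once and is the
  induction step for finite linear combinations.\<close>

lemma christ_lin_left:
  "christ x (\<lambda>m. v m + z * v' m) w e = christ x v w e + z * christ x v' w e"
proof -
  let ?S = "\<lambda>v. \<Sum>i\<in>I. (2 * f1 i (x i) + 1) * x (sx i) * v i * w i
            + F i (x i) * (v i * w (sx i) + v (sx i) * w i)"
  have S: "?S (\<lambda>m. v m + z * v' m) = ?S v + z * ?S v'"
    unfolding sum_distrib_left sum.distrib[symmetric]
    by (rule sum.cong) (simp_all add: algebra_simps)
  show ?thesis
    unfolding christ_def mkvec_lin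
    by (rule fun_cong[OF mkvec_cong])
      (simp, simp, simp only: S simp_thms if_True, simp_all add: algebra_simps)
qed

lemma christ_lin_right:
  "christ x w (\<lambda>m. v m + z * v' m) e = christ x w v e + z * christ x w v' e"
  using christ_lin_left[of x v z v' w e] by (simp add: christ_sym[of x w])

lemma christ_zero: "christ x (\<lambda>m. 0) w e = 0"
  using christ_lin_left[of x "\<lambda>m. 0" 1 "\<lambda>m. 0" w e] by simp

lemma christ_sum_left:
  "christ x (\<lambda>m. \<Sum>a\<in>S. z a * v a m) w e = (\<Sum>a\<in>S. z a * christ x (v a) w e)"
proof (induction S rule: infinite_finite_induct)
  case (insert a S)
  then show ?case
    using christ_lin_left[of x "\<lambda>m. \<Sum>a\<in>S. z a * v a m" "z a" "v a" w e] by (simp add: add.commute)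
qed (simp_all add: christ_zero)

lemma christ_sum_right:
  "christ x w (\<lambda>m. \<Sum>a\<in>S. z a * v a m) e = (\<Sum>a\<in>S. z a * christ x w (v a) e)"
  using christ_sum_left[where S = S and z = z and v = v and w = w and x = x and e = e] by (simp add: christ_sym[of x w])

lemma christ_cong:
  assumes "\<And>a. a < N \<Longrightarrow> v a = v' a" "\<And>a. a < N \<Longrightarrow> w a = w' a"
  shows "christ x v w = christ x v' w'"
  unfolding christ_def
  by (intro mkvec_cong) (auto simp: assms intro!: sum.cong)

lemma ev_expand: "m < N \<Longrightarrow> (\<Sum>a<N. v a * ev a m) = v m"
  by (simp add: ev_def if_distrib[of "\<lambda>z. _ * z"] cong: if_cong)

lemma chr_sum:
  assumes "e < N"
  shows "(\<Sum>a<N. v a * (\<Sum>b<N. chr N g e a b x * w b)) = christ x v w e"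
proof -
  have "christ x v w e = christ x (\<lambda>m. \<Sum>a<N. v a * ev a m) (\<lambda>m. \<Sum>b<N. w b * ev b m) e"
    by (rule fun_cong[OF christ_cong]) (simp_all add: ev_expand)
  then show ?thesis
    using assms by (simp add: christ_sum_left christ_sum_right chr_eq mult.commute)
qed

lemma conn_eq:
  "conn N g X Y x e = (if e < N then ddir N X (\<lambda>y. Y y e) x else 0) + christ x (X x) (Y x) e"
proof (cases "e < N")
  case True
  then show ?thesis
    by (simp add: conn_def ddir_def distrib_left sum.distrib chr_sum)
qed (simp add: conn_def)

lemma smooth_alg_F: "i \<in> I \<Longrightarrow> smooth_alg N (\<lambda>x. F i (x i))"
  and smooth_alg_f1: "i \<in> I \<Longrightarrow> smooth_alg N (\<lambda>x. f1 i (x i))"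
  by (simp_all add: smooth_alg.gen smooth_F smooth_fn_deriv)

lemma smooth_alg_christ:
  assumes "smooth_field N X" "smooth_field N Y" "e < N"
  shows "smooth_alg N (\<lambda>x. christ x (X x) (Y x) e)"
proof -
  have n: "a < N \<Longrightarrow> smooth_alg N (\<lambda>x. X x a)" "a < N \<Longrightarrow> smooth_alg N (\<lambda>x. Y x a)" for a
    using assms by (auto simp: smooth_field_def)
  show ?thesis
    using assms(3)
    by (cases rule: idx_cases) (simp_all add: christ_def, (intro smooth_alg_intros n smooth_alg_F smooth_alg_f1; simp)+)
qed

lemma smooth_alg_conn:
  assumes "smooth_field N X" "smooth_field N Y"
  shows "smooth_field N (conn N g X Y)"
  using assms unfolding smooth_field_def conn_eq
  by (auto intro!: smooth_alg.add smooth_alg_christ smooth_alg_ddir simp: smooth_field_def)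

lemma ddir_add:
  assumes "smooth_alg N h1" "smooth_alg N h2"
  shows "ddir N X (\<lambda>x. h1 x + h2 x) x = ddir N X h1 x + ddir N X h2 x"
  by (simp add: ddir_def pd_add[OF assms] distrib_left sum.distrib)

lemma ddir_christ:
  assumes "smooth_field N Y" "smooth_field N Z" "e < N"
  shows "ddir N X (\<lambda>x. christ x (Y x) (Z x) e) x = dchrist x (X x) (Y x) (Z x) e
      + christ x (\<lambda>m. ddir N X (\<lambda>y. Y y m) x) (Z x) e + christ x (Y x) (\<lambda>m. ddir N X (\<lambda>y. Z y m) x) e"
proof -
  let ?c = "\<lambda>t m. x m + t * X x m"
  have "((\<lambda>t. christ (?c t) (Y (?c t)) (Z (?c t)) e) has_real_derivative
     dchrist (?c 0) (X x) (Y (?c 0)) (Z (?c 0)) e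
      + christ (?c 0) (\<lambda>m. ddir N X (\<lambda>y. Y y m) x) (Z (?c 0)) e
      + christ (?c 0) (Y (?c 0)) (\<lambda>m. ddir N X (\<lambda>y. Z y m) x) e) (at 0)"
  proof (rule christ_DERIV)
    show "((\<lambda>t. ?c t a) has_real_derivative X x a) (at 0)" for a
      by (auto intro!: derivative_eq_intros)
  qed (use assms in \<open>auto intro!: ddir_DERIV simp: smooth_field_def\<close>)
  with ddir_DERIV[OF smooth_alg_christ[OF assms], of x X] show ?thesis
    by (simp add: DERIV_unique)
qed

definition riem :: "pt \<Rightarrow> pt \<Rightarrow> pt \<Rightarrow> pt \<Rightarrow> pt" where
  "riem x u v w = (\<lambda>e. dchrist x u v w e - dchrist x v u w e + christ x u (christ x v w) e - christ x v (christ x u w) e)"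

lemma conn_conn:
  assumes X: "smooth_field N X" and Y: "smooth_field N Y" and Z: "smooth_field N Z" and e: "e < N"
  shows "conn N g X (conn N g Y Z) x e = ddir N X (ddir N Y (\<lambda>y. Z y e)) x
      + dchrist x (X x) (Y x) (Z x) e + christ x (\<lambda>m. ddir N X (\<lambda>y. Y y m) x) (Z x) e
      + christ x (Y x) (\<lambda>m. ddir N X (\<lambda>y. Z y m) x) e
      + christ x (X x) (\<lambda>m. ddir N Y (\<lambda>y. Z y m) x) e + christ x (X x) (christ x (Y x) (Z x)) e"
proof -
  have "smooth_alg N (\<lambda>y. ddir N Y (\<lambda>y. Z y e) y)"
    using Y Z e by (auto intro!: smooth_alg_ddir simp: smooth_field_def)
  moreover have "christ x (X x) (conn N g Y Z x) e
      = christ x (X x) (\<lambda>m. ddir N Y (\<lambda>y. Z y m) x + 1 * christ x (Y x) (Z x) m) e"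
    by (rule fun_cong[OF christ_cong]) (simp_all add: conn_eq)
  ultimately show ?thesis
    using e unfolding christ_lin_right
    by (simp add: conn_eq[of X] conn_eq[of Y Z _ e] ddir_add smooth_alg_christ[OF Y Z] ddir_christ[OF Y Z])
qed

lemma gval_cong:
  assumes "\<And>a. a < N \<Longrightarrow> v a = v' a" "\<And>a. a < N \<Longrightarrow> w a = w' a"
  shows "gval N g x v w = gval N g x v' w'"
  unfolding gval_def using assms by simp

text \<open>All derivatives of the fields cancel between the two iterated covariant derivatives and
  the bracket term, so only the values at \<open>x\<close> remain: the curvature is a
  tensor.\<close>

lemma curv_riem:
  assumes X: "smooth_field N X" and Y: "smooth_field N Y" and Z: "smooth_field N Z"
  shows "curv N g X Y Z W x = gval N g x (riem x (X x) (Y x) (Z x)) (W x)"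
  unfolding curv_def
proof (rule gval_cong)
  fix e assume e: "e < N"
  have "christ x (lie N X Y x) (Z x) e = christ x (\<lambda>m. ddir N X (\<lambda>y. Y y m) x + (-1) * ddir N Y (\<lambda>y. X y m) x) (Z x) e"
    by (rule fun_cong[OF christ_cong]) (simp_all add: lie_def)
  then have lie: "conn N g (lie N X Y) Z x e = ddir N X (ddir N Y (\<lambda>y. Z y e)) x - ddir N Y (ddir N X (\<lambda>y. Z y e)) x
     + christ x (\<lambda>m. ddir N X (\<lambda>y. Y y m) x) (Z x) e - christ x (\<lambda>m. ddir N Y (\<lambda>y. X y m) x) (Z x) e"
    using e Z unfolding christ_lin_left
    by (simp add: conn_eq ddir_commutator[OF X Y] smooth_field_def)
  show "conn N g X (conn N g Y Z) x e - conn N g Y (conn N g X Z) x e - conn N g (lie N X Y) Z x e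
      = riem x (X x) (Y x) (Z x) e"
    unfolding conn_conn[OF X Y Z e] conn_conn[OF Y X Z e] lie riem_def by simp
qed simp

section \<open>The covariant derivatives of the curvature\<close>

definition du0_du :: "nat \<Rightarrow> pt \<Rightarrow> pt \<Rightarrow> real" where
  "du0_du i v w = v 0 * w i - v i * w 0"

definition du_ds :: "nat \<Rightarrow> pt \<Rightarrow> pt \<Rightarrow> real" where
  "du_ds i v w = v i * w (sx i) - v (sx i) * w i"

text \<open>Order 0 is separate because \<open>1 + f1 i\<close> is not an iterated derivative of
  \<open>F i\<close>; from there on each coefficient is the derivative of the preceding one.\<close>

definition p_coeff :: "nat \<Rightarrow> nat \<Rightarrow> real \<Rightarrow> real" where
  "p_coeff i l u = (if l = 0 then 1 + f1 i u else (deriv ^^ (l + 1)) (F i) u)"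

text \<open>The start value is the part of \<open>R\<close> quadratic in the Christoffel symbols.
  Each covariant derivative adds two equal contributions, one from \<open>du_ds i\<close> in either
  half of the symmetric product.\<close>

primrec h_coeff :: "nat \<Rightarrow> nat \<Rightarrow> real \<Rightarrow> real" where
  "h_coeff i 0 = (\<lambda>u. eps i * (F i u * F i u))"
| "h_coeff i (Suc l) = (\<lambda>u. deriv (h_coeff i l) u + 2 * eps i * (F i u * p_coeff i l u))"

definition curv_coeff :: "nat \<Rightarrow> nat \<Rightarrow> pt \<Rightarrow> pt \<Rightarrow> pt \<Rightarrow> pt \<Rightarrow> pt \<Rightarrow> real" where
  "curv_coeff i l x v1 v2 v3 v4 = p_coeff i l (x i) * (du0_du i v1 v2 * du_ds i v3 v4 + du_ds i v1 v2 * du0_du i v3 v4)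
     - h_coeff i l (x i) * (du0_du i v1 v2 * du0_du i v3 v4)"

text \<open>The closed form of \<open>\<nabla>\<^sup>lR\<close>: with \<open>p\<close>, \<open>h\<close> the two coefficient functions, it is the sum over \<open>i\<close> of
  \<open>p (du\<^sub>0\<and>du\<^sub>i) \<odot> (du\<^sub>i\<and>ds\<^sub>i) \<otimes> du\<^sub>i\<^sup>l - h (du\<^sub>0\<and>du\<^sub>i) \<otimes> (du\<^sub>0\<and>du\<^sub>i) \<otimes> du\<^sub>i\<^sup>l\<close>.
  The first four list entries are the curvature slots.\<close>

definition curv_form :: "nat \<Rightarrow> pt \<Rightarrow> pt list \<Rightarrow> real" where
  "curv_form l x vs = (\<Sum>i\<in>I. curv_coeff i l x (vs ! 0) (vs ! 1) (vs ! 2) (vs ! 3) * (\<Prod>y\<leftarrow>drop 4 vs. y i))"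

lemma smooth_p_coeff: "i \<in> I \<Longrightarrow> smooth_fn (p_coeff i l)"
proof (induction l)
  case 0
  then show ?case
    using smooth_fn_add[OF smooth_fn_const smooth_fn_deriv[OF smooth_F], of i 1] by (simp add: p_coeff_def[abs_def])
next
  case (Suc l)
  have "smooth_fn ((deriv ^^ n) (F i))" for n
    by (induction n) (auto intro: smooth_F Suc.prems smooth_fn_deriv)
  from this[of "Suc (Suc l)"] show ?case by (simp add: p_coeff_def[abs_def])
qed

lemma p_coeff_DERIV:
  assumes "i \<in> I"
  shows "(p_coeff i l has_real_derivative p_coeff i (Suc l) u) (at u)"
proof -
  have "deriv (p_coeff i l) u = p_coeff i (Suc l) u"
  proof (cases l)
    case 0
    then show ?thesis
      using f1_DERIV[OF assms] by (auto simp: p_coeff_def[abs_def] intro!: DERIV_imp_deriv derivative_eq_intros)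
  qed (simp add: p_coeff_def[abs_def])
  then show ?thesis using smooth_fn_DERIV[OF smooth_p_coeff[OF assms], of l u] by simp
qed

lemma smooth_h_coeff: "i \<in> I \<Longrightarrow> smooth_fn (h_coeff i l)"
  by (induction l) (simp_all add: smooth_fn_mult smooth_fn_add smooth_fn_const smooth_F smooth_p_coeff smooth_fn_deriv)

lemma h_coeff_DERIV:
  assumes "i \<in> I"
  shows "(h_coeff i l has_real_derivative h_coeff i (Suc l) u - 2 * eps i * (F i u * p_coeff i l u)) (at u)"
  using smooth_fn_DERIV[OF smooth_h_coeff[OF assms], of l u] by simp

text \<open>The base case of the closed form. The curvature operator has no
  \<open>u\<close>-components, so its pairing with \<open>z\<close> involves only its
  \<open>v\<close>- and \<open>s\<close>-components; the \<open>vx 0\<close> component is again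
  distributed over \<open>I\<close>.\<close>

lemma riem_curv_form: "gval N g x (riem x u v w) z = curv_form 0 x [u, v, w, z]"
proof -
  let ?r = "riem x u v w"
  let ?R = "\<lambda>i. (2 * f2 i (x i) * u i * x (sx i) + (2 * f1 i (x i) + 1) * u (sx i)) * v i * w i
            + f1 i (x i) * u i * (v i * w (sx i) + v (sx i) * w i)
     - ((2 * f2 i (x i) * v i * x (sx i) + (2 * f1 i (x i) + 1) * v (sx i)) * u i * w i
            + f1 i (x i) * v i * (u i * w (sx i) + u (sx i) * w i))
     + F i (x i) * (u i * christ x v w (sx i)) - F i (x i) * (v i * christ x u w (sx i))"
  have r0: "?r (vx 0) = (\<Sum>i\<in>I. ?R i)"
    unfolding riem_def christ_def[of x u "christ x v w"] christ_def[of x v "christ x u w"] dchrist_def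
    by (simp add: sum.distrib sum_subtractf)
  have "gval N g x ?r z = (\<Sum>i\<in>I. ?r (vx i) * z i + eps i * ?r (sx i) * z (sx i)) + ?r (vx 0) * z 0"
  proof -
    have "?r 0 = 0" "\<And>i. i \<in> I \<Longrightarrow> ?r i = 0" by (simp_all add: riem_def dchrist_def)
    then show ?thesis by (simp add: gval_eq)
  qed
  also have "\<dots> = (\<Sum>i\<in>I. ?r (vx i) * z i + eps i * ?r (sx i) * z (sx i) + ?R i * z 0)"
    by (simp only: r0 sum.distrib sum_distrib_right)
  also have "\<dots> = (\<Sum>i\<in>I. curv_coeff i 0 x u v w z)"
  proof (rule sum.cong)
    fix i assume i: "i \<in> I"
    have rv: "?r (vx i) = - u (sx i) * (v 0 * w i + v i * w 0) + f1 i (x i) * u i * (v 0 * w (sx i) + v (sx i) * w 0)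
            - u 0 * (v i * w (sx i) + v (sx i) * w i)
        - (- v (sx i) * (u 0 * w i + u i * w 0) + f1 i (x i) * v i * (u 0 * w (sx i) + u (sx i) * w 0)
            - v 0 * (u i * w (sx i) + u (sx i) * w i))
        + (F i (x i) * u 0 - x 0 * u i) * christ x v w (sx i) - (F i (x i) * v 0 - x 0 * v i) * christ x u w (sx i)"
      using i unfolding riem_def christ_def[of x u "christ x v w"] christ_def[of x v "christ x u w"] dchrist_def
      by (simp add: algebra_simps)
    have rs: "?r (sx i) = eps i * ((1 + f1 i (x i)) * du0_du i u v * w i)"
      using i unfolding riem_def christ_def[of x u "christ x v w"] christ_def[of x v "christ x u w"] dchrist_def
      by (simp add: du0_du_def algebra_simps)
    have es: "eps i * (eps i * y) = y" for y
      using eps_sq[OF i] by (simp flip: mult.assoc)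
    have rs': "eps i * ?r (sx i) = (1 + f1 i (x i)) * du0_du i u v * w i"
      by (simp add: rs es)
    show "?r (vx i) * z i + eps i * ?r (sx i) * z (sx i) + ?R i * z 0 = curv_coeff i 0 x u v w z"
      unfolding rv rs' christ_simps(4)[OF i] curv_coeff_def p_coeff_def du0_du_def du_ds_def h_coeff.simps
      by (simp add: algebra_simps)
  qed simp
  finally show ?thesis by (simp add: curv_form_def)
qed

section \<open>Covariant differentiation of the closed form\<close>

text \<open>Each summand is the original list with a single entry replaced, which is the shape of
  the correction terms in \<open>covD\<close>.\<close>

lemma prod_list_DERIV:
  assumes "length ys' = length ys" "\<And>j. j < length ys \<Longrightarrow> ((ys ! j) has_real_derivative ys' ! j) (at 0)"
  shows "((\<lambda>t. \<Prod>y\<leftarrow>ys. y t) has_real_derivative (\<Sum>j<length ys. prod_list ((map (\<lambda>y. y 0) ys)[j := ys' ! j]))) (at 0)"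
  using assms
proof (induction ys arbitrary: ys')
  case (Cons y ys)
  then obtain z zs where z: "ys' = z # zs" by (cases ys') auto
  have "(y has_real_derivative z) (at 0)" using Cons.prems(2)[of 0] z by simp
  moreover have "((\<lambda>t. \<Prod>y\<leftarrow>ys. y t) has_real_derivative (\<Sum>j<length ys. prod_list ((map (\<lambda>y. y 0) ys)[j := zs ! j]))) (at 0)"
    using Cons.IH[of zs] Cons.prems(1) Cons.prems(2)[of "Suc _"] z by simp
  ultimately have "((\<lambda>t. y t * (\<Prod>y\<leftarrow>ys. y t)) has_real_derivative
      z * (\<Prod>y\<leftarrow>ys. y 0) + (\<Sum>j<length ys. prod_list ((map (\<lambda>y. y 0) ys)[j := zs ! j])) * y 0) (at 0)"
    by (rule DERIV_mult)
  then show ?case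
    by (simp add: z sum.lessThan_Suc_shift sum_distrib_left mult.commute[of _ "y 0"] del: sum.lessThan_Suc)
qed simp

text \<open>The forms \<open>du\<^sub>i\<close> are parallel and the covariant derivative of \<open>du\<^sub>i \<and> ds\<^sub>i\<close> along \<open>y\<close> is
  \<open>eps\<^sub>i f\<^sub>i du\<^sub>i(y) du\<^sub>i \<and> du\<^sub>0\<close>; this is the source of the recursion for \<open>h_coeff\<close>.\<close>

lemma curv_coeff_DERIV:
  assumes i: "i \<in> I" and c: "\<And>a. a < N \<Longrightarrow> ((\<lambda>t. c t a) has_real_derivative c' a) (at 0)"
    and v: "\<And>a. a < N \<Longrightarrow> ((\<lambda>t. v1 t a) has_real_derivative v1' a) (at 0)"
      "\<And>a. a < N \<Longrightarrow> ((\<lambda>t. v2 t a) has_real_derivative v2' a) (at 0)"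
      "\<And>a. a < N \<Longrightarrow> ((\<lambda>t. v3 t a) has_real_derivative v3' a) (at 0)"
      "\<And>a. a < N \<Longrightarrow> ((\<lambda>t. v4 t a) has_real_derivative v4' a) (at 0)"
  shows "((\<lambda>t. curv_coeff i l (c t) (v1 t) (v2 t) (v3 t) (v4 t)) has_real_derivative
     curv_coeff i (Suc l) (c 0) (v1 0) (v2 0) (v3 0) (v4 0) * c' i
     + curv_coeff i l (c 0) (\<lambda>m. v1' m + christ (c 0) c' (v1 0) m) (v2 0) (v3 0) (v4 0)
     + curv_coeff i l (c 0) (v1 0) (\<lambda>m. v2' m + christ (c 0) c' (v2 0) m) (v3 0) (v4 0)
     + curv_coeff i l (c 0) (v1 0) (v2 0) (\<lambda>m. v3' m + christ (c 0) c' (v3 0) m) (v4 0)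
     + curv_coeff i l (c 0) (v1 0) (v2 0) (v3 0) (\<lambda>m. v4' m + christ (c 0) c' (v4 0) m)) (at 0)"
proof -
  have ic: "((\<lambda>t. c t i) has_real_derivative c' i) (at 0)" using c i by simp
  have dv: "((\<lambda>t. du0_du i (v t) (w t)) has_real_derivative du0_du i v' (w 0) + du0_du i (v 0) w') (at 0)"
    "((\<lambda>t. du_ds i (v t) (w t)) has_real_derivative du_ds i v' (w 0) + du_ds i (v 0) w') (at 0)"
    if "\<And>a. a < N \<Longrightarrow> ((\<lambda>t. v t a) has_real_derivative v' a) (at 0)"
       "\<And>a. a < N \<Longrightarrow> ((\<lambda>t. w t a) has_real_derivative w' a) (at 0)" for v w v' w'
    unfolding du0_du_def du_ds_def using i
    by (auto intro!: derivative_eq_intros that simp: algebra_simps)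
  \<comment> \<open>\<open>christ\<close> has no \<open>u\<close>-components, so correcting a slot
    by it does not change this form.\<close>
  have du0_du_christ: "du0_du i (\<lambda>m. v m + christ x y v0 m) w = du0_du i v w"
    "du0_du i w (\<lambda>m. v m + christ x y v0 m) = du0_du i w v" for x y v v0 w
    using i by (simp_all add: du0_du_def)
  have du_ds_christ: "du_ds i (\<lambda>m. v m + christ x y v0 m) w = du_ds i v w - christ x y v0 (sx i) * w i"
    "du_ds i w (\<lambda>m. v m + christ x y v0 m) = du_ds i w v + w i * christ x y v0 (sx i)" for x y v v0 w
    using i by (simp_all add: du_ds_def algebra_simps)
  \<comment> \<open>In the \<open>s\<close>-component of \<open>christ\<close> the terms with
    \<open>x 0\<close> and \<open>y 0\<close> are symmetric after multiplication and cancel; the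
    rest is a multiple of \<open>du0_du i\<close>.\<close>
  have du_ds_par: "v i * christ x y w (sx i) = christ x y v (sx i) * w i + eps i * F i (x i) * y i * du0_du i v w" for x y v w
    using i by (simp add: du0_du_def algebra_simps)
  show ?thesis
    unfolding curv_coeff_def
    apply (rule DERIV_cong)
     apply (rule derivative_intros DERIV_chain2[OF p_coeff_DERIV[OF i] ic] DERIV_chain2[OF h_coeff_DERIV[OF i] ic]
        dv v | assumption)+
    unfolding du0_du_christ du_ds_christ du_ds_par[of "v1 0" "c 0" c' "v2 0"] du_ds_par[of "v3 0" "c 0" c' "v4 0"]
    by (simp add: algebra_simps del: christ_simps h_coeff.simps)
qed

text \<open>The covariant product rule along a curve: \<open>vs' + christ\<close> is the covariant
  derivative of a slot. Arbitrary curves are allowed because the rule serves both for vector fields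
  along a line and for frames carried along by a local isometry.\<close>

lemma curv_form_DERIV:
  assumes len: "length vs = 4 + l" "length vs' = 4 + l"
    and c: "\<And>a. a < N \<Longrightarrow> ((\<lambda>t. c t a) has_real_derivative c' a) (at 0)"
    and v: "\<And>j a. j < 4 + l \<Longrightarrow> a < N \<Longrightarrow> ((\<lambda>t. (vs ! j) t a) has_real_derivative (vs' ! j) a) (at 0)"
  shows "((\<lambda>t. curv_form l (c t) (map (\<lambda>v. v t) vs)) has_real_derivative
     curv_form (Suc l) (c 0) (map (\<lambda>v. v 0) vs @ [c'])
     + (\<Sum>j<4 + l. curv_form l (c 0) ((map (\<lambda>v. v 0) vs)[j := \<lambda>m. (vs' ! j) m + christ (c 0) c' ((vs ! j) 0) m]))) (at 0)"
proof -
  obtain v1 v2 v3 v4 ys where vs: "vs = v1 # v2 # v3 # v4 # ys" and ys: "length ys = l"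
    using len(1) by (auto simp: length_Suc_conv numeral_eq_Suc)
  obtain v1' v2' v3' v4' ys' where vs': "vs' = v1' # v2' # v3' # v4' # ys'" and ys': "length ys' = l"
    using len(2) by (auto simp: length_Suc_conv numeral_eq_Suc)
  have v14: "\<And>a. a < N \<Longrightarrow> ((\<lambda>t. v1 t a) has_real_derivative v1' a) (at 0)"
      "\<And>a. a < N \<Longrightarrow> ((\<lambda>t. v2 t a) has_real_derivative v2' a) (at 0)"
      "\<And>a. a < N \<Longrightarrow> ((\<lambda>t. v3 t a) has_real_derivative v3' a) (at 0)"
      "\<And>a. a < N \<Longrightarrow> ((\<lambda>t. v4 t a) has_real_derivative v4' a) (at 0)"
    using v[of 0] v[of 1] v[of 2] v[of 3] by (auto simp: vs vs' numeral_eq_Suc)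
  have vy: "((\<lambda>t. (ys ! j) t a) has_real_derivative (ys' ! j) a) (at 0)" if "j < l" "a < N" for j a
    using v[of "4 + j"] that by (simp add: vs vs' numeral_eq_Suc)
  let ?C = "\<lambda>i t. curv_coeff i l (c t) (v1 t) (v2 t) (v3 t) (v4 t)"
  let ?P = "\<lambda>i t. \<Prod>y\<leftarrow>ys. y t i"
  let ?P' = "\<lambda>i j. prod_list ((map (\<lambda>y. y 0 i) ys)[j := (ys' ! j) i])"
  let ?C' = "\<lambda>i. curv_coeff i (Suc l) (c 0) (v1 0) (v2 0) (v3 0) (v4 0) * c' i
     + curv_coeff i l (c 0) (\<lambda>m. v1' m + christ (c 0) c' (v1 0) m) (v2 0) (v3 0) (v4 0)
     + curv_coeff i l (c 0) (v1 0) (\<lambda>m. v2' m + christ (c 0) c' (v2 0) m) (v3 0) (v4 0)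
     + curv_coeff i l (c 0) (v1 0) (v2 0) (\<lambda>m. v3' m + christ (c 0) c' (v3 0) m) (v4 0)
     + curv_coeff i l (c 0) (v1 0) (v2 0) (v3 0) (\<lambda>m. v4' m + christ (c 0) c' (v4 0) m)"
  have P: "(?P i has_real_derivative (\<Sum>j<l. ?P' i j)) (at 0)" if i: "i \<in> I" for i
    using prod_list_DERIV[of "map (\<lambda>y. y i) ys'" "map (\<lambda>y t. y t i) ys"] vy i ys ys'
    by (simp add: comp_def)
  have "((\<lambda>t. \<Sum>i\<in>I. ?C i t * ?P i t) has_real_derivative
      (\<Sum>i\<in>I. ?C' i * ?P i 0 + (\<Sum>j<l. ?P' i j) * ?C i 0)) (at 0)"
    by (intro DERIV_sum DERIV_mult curv_coeff_DERIV P c v14)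
  also have "(\<Sum>i\<in>I. ?C' i * ?P i 0 + (\<Sum>j<l. ?P' i j) * ?C i 0)
     = curv_form (Suc l) (c 0) (map (\<lambda>v. v 0) vs @ [c'])
     + (\<Sum>j<4 + l. curv_form l (c 0) ((map (\<lambda>v. v 0) vs)[j := \<lambda>m. (vs' ! j) m + christ (c 0) c' ((vs ! j) 0) m]))"
  proof -
    \<comment> \<open>The slots after the fourth enter through their \<open>u\<close>-components
      only, where \<open>christ\<close> vanishes, so the plain Leibniz terms are already the
      covariant ones.\<close>
    have tail: "(\<Sum>j<l. curv_form l (c 0) (v1 0 # v2 0 # v3 0 # v4 0 #
         (map (\<lambda>v. v 0) ys)[j := \<lambda>m. (ys' ! j) m + christ (c 0) c' ((ys ! j) 0) m]))
       = (\<Sum>i\<in>I. (\<Sum>j<l. ?P' i j) * ?C i 0)"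
      unfolding sum_distrib_right
      by (subst sum.swap) (simp add: curv_form_def map_update comp_def numeral_eq_Suc mult.commute)
    show ?thesis
      unfolding vs vs'
      by (simp add: sum.lessThan_Suc_shift tail numeral_eq_Suc add.assoc del: sum.lessThan_Suc)
        (simp add: curv_form_def numeral_eq_Suc sum.distrib distrib_right distrib_left comp_def mult_ac)
  qed
  finally show ?thesis
    by (simp add: curv_form_def vs numeral_eq_Suc comp_def)
qed

lemma smooth_alg_curv_form:
  assumes "\<And>X. X \<in> set Xs \<Longrightarrow> smooth_field N X" "length Xs = 4 + l"
  shows "smooth_alg N (\<lambda>x. curv_form l x (map (\<lambda>X. X x) Xs))"
proof -
  obtain A B C D Ys where Xs: "Xs = A # B # C # D # Ys"
    using assms(2) by (auto simp: length_Suc_conv numeral_eq_Suc)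
  have n: "smooth_alg N (\<lambda>x. A x a)" "smooth_alg N (\<lambda>x. B x a)" "smooth_alg N (\<lambda>x. C x a)" "smooth_alg N (\<lambda>x. D x a)"
    "\<And>Y. Y \<in> set Ys \<Longrightarrow> smooth_alg N (\<lambda>x. Y x a)" if "a < N" for a
    using assms(1) that unfolding Xs smooth_field_def by auto
  have hp: "smooth_alg N (\<lambda>x. p_coeff i l (x i))" "smooth_alg N (\<lambda>x. h_coeff i l (x i))" if "i \<in> I" for i
    using that by (simp_all add: smooth_alg.gen smooth_p_coeff smooth_h_coeff)
  show ?thesis
    unfolding Xs curv_form_def curv_coeff_def du0_du_def du_ds_def
    by (simp add: numeral_eq_Suc comp_def) (intro smooth_alg_intros smooth_alg_prod_list n(1-4) hp; simp add: n(5))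
qed

text \<open>Along the line with velocity \<open>Y x\<close> each corrected slot is the value of
  \<open>conn N g Y\<close>, so the slot sum cancels against the one in \<open>covD\<close> and the
  closed form of the next order remains.\<close>

lemma nablaR_curv_form:
  assumes "\<And>X. X \<in> set Xs \<Longrightarrow> smooth_field N X" "length Xs = 4 + l"
  shows "nablaR N g l Xs x = curv_form l x (map (\<lambda>X. X x) Xs)"
  using assms
proof (induction l arbitrary: Xs x)
  case 0
  then obtain A B C D where "Xs = [A, B, C, D]"
    by (auto simp: length_Suc_conv numeral_eq_Suc)
  with 0 show ?case
    by (simp add: curvT_def curv_riem riem_curv_form)
next
  case (Suc l)
  define Ys Y where "Ys = butlast Xs" and "Y = last Xs"
  have Xs: "Xs = Ys @ [Y]"
    using Suc.prems(2) unfolding Ys_def Y_def by (metis append_butlast_last_id list.size(3) add_Suc_right nat.distinct(1))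
  have len: "length Ys = 4 + l" using Suc.prems(2) Xs by simp
  have nY: "smooth_field N Y" and nYs: "\<And>X. X \<in> set Ys \<Longrightarrow> smooth_field N X"
    using Suc.prems(1) Xs by auto
  let ?c = "\<lambda>t m. x m + t * Y x m"
  let ?vs = "map (\<lambda>X t. X (?c t)) Ys"
  \<comment> \<open>The cut-off at \<open>N\<close> makes the corrected slot equal to
    \<open>conn\<close> as a function of all indices.\<close>
  let ?vs' = "map (\<lambda>X m. if m < N then ddir N Y (\<lambda>y. X y m) x else 0) Ys"
  \<comment> \<open>Besides \<open>Ys\<close> itself, \<open>covD\<close> evaluates the tensor on
    lists with one slot replaced by a covariant derivative, which is again a smooth field.\<close>
  have IH: "nablaR N g l Zs y = curv_form l y (map (\<lambda>X. X y) Zs)" if "Zs = Ys \<or> (\<exists>j<4+l. Zs = Ys[j := conn N g Y (Ys ! j)])" for Zs y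
  proof (rule Suc.IH)
    fix X assume "X \<in> set Zs"
    then have "X \<in> set Ys \<or> (\<exists>j<4+l. X = conn N g Y (Ys ! j))"
      using that set_update_subset_insert by fastforce
    then show "smooth_field N X"
      using nYs smooth_alg_conn[OF nY nYs] len by auto
  qed (use that len in auto)
  have "((\<lambda>t. curv_form l (?c t) (map (\<lambda>v. v t) ?vs)) has_real_derivative
     curv_form (Suc l) (?c 0) (map (\<lambda>v. v 0) ?vs @ [Y x])
     + (\<Sum>j<4 + l. curv_form l (?c 0) ((map (\<lambda>v. v 0) ?vs)[j := \<lambda>m. (?vs' ! j) m + christ (?c 0) (Y x) ((?vs ! j) 0) m]))) (at 0)"
  proof (rule curv_form_DERIV)
    show "((\<lambda>t. ?c t a) has_real_derivative Y x a) (at 0)" for a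
      by (auto intro!: derivative_eq_intros)
    fix j a assume ja: "j < 4 + l" "a < N"
    then have "smooth_alg N (\<lambda>x. (Ys ! j) x a)"
      using nYs[of "Ys ! j"] len by (simp add: smooth_field_def)
    from ddir_DERIV[OF this, of x Y] show "((\<lambda>t. (?vs ! j) t a) has_real_derivative (?vs' ! j) a) (at 0)"
      using ja len by simp
  qed (simp_all add: len)
  moreover have "((\<lambda>t. curv_form l (?c t) (map (\<lambda>v. v t) ?vs)) has_real_derivative ddir N Y (nablaR N g l Ys) x) (at 0)"
  proof -
    have eq: "nablaR N g l Ys = (\<lambda>x. curv_form l x (map (\<lambda>X. X x) Ys))"
      using IH by auto
    show ?thesis
      using ddir_DERIV[OF smooth_alg_curv_form[OF nYs len], of x Y] unfolding eq by (simp add: comp_def)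
  qed
  ultimately have "ddir N Y (nablaR N g l Ys) x = curv_form (Suc l) (?c 0) (map (\<lambda>v. v 0) ?vs @ [Y x])
     + (\<Sum>j<4 + l. curv_form l (?c 0) ((map (\<lambda>v. v 0) ?vs)[j := \<lambda>m. (?vs' ! j) m + christ (?c 0) (Y x) ((?vs ! j) 0) m]))"
    using DERIV_unique by blast
  also have "\<dots> = curv_form (Suc l) x (map (\<lambda>X. X x) Xs) + (\<Sum>j<4 + l. nablaR N g l (Ys[j := conn N g Y (Ys ! j)]) x)"
  proof -
    have "(map (\<lambda>v. v 0) ?vs)[j := \<lambda>m. (?vs' ! j) m + christ (?c 0) (Y x) ((?vs ! j) 0) m]
       = map (\<lambda>X. X x) (Ys[j := conn N g Y (Ys ! j)])" if "j < 4 + l" for j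
    proof -
      have "(\<lambda>m. (?vs' ! j) m + christ (?c 0) (Y x) ((?vs ! j) 0) m) = conn N g Y (Ys ! j) x"
        using that len by (auto simp: conn_eq)
      then show ?thesis by (simp add: map_update comp_def)
    qed
    moreover have "nablaR N g l (Ys[j := conn N g Y (Ys ! j)]) x
       = curv_form l x (map (\<lambda>X. X x) (Ys[j := conn N g Y (Ys ! j)]))" if "j < 4 + l" for j
      using IH that by blast
    ultimately show ?thesis by (simp add: Xs comp_def)
  qed
  finally show ?case by (simp add: covD_def Ys_def[symmetric] Y_def[symmetric] len)
qed

lemma tensor_at_curv_form:
  assumes "length vs = 4 + l"
  shows "tensor_at (nablaR N g l) x vs = curv_form l x vs"
  unfolding tensor_at_def
  by (subst nablaR_curv_form) (auto simp: smooth_field_def assms comp_def intro: smooth_alg.const)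

end

section \<open>Isomorphisms of models\<close>

text \<open>For square matrices a one-sided inverse is two-sided; the coefficient functions are
  packed into matrices to use this.\<close>

lemma left_inverse_right_inverse:
  fixes a b :: "nat \<Rightarrow> nat \<Rightarrow> real"
  assumes "\<And>i j. i < n \<Longrightarrow> j < n \<Longrightarrow> (\<Sum>m<n. a i m * b m j) = (if i = j then 1 else 0)"
    and ij: "i < n" "j < n"
  shows "(\<Sum>m<n. b i m * a m j) = (if i = j then 1 else 0)"
proof -
  let ?A = "mat n n (\<lambda>(i, j). a i j)" and ?B = "mat n n (\<lambda>(i, j). b i j)"
  have "?A * ?B = 1\<^sub>m n"
    by (rule eq_matI) (use assms(1) in \<open>auto simp: scalar_prod_def lessThan_atLeast0\<close>)
  then have "?B * ?A = 1\<^sub>m n"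
    by (intro mat_mult_left_right_inverse[of ?A n ?B]) auto
  then have "(?B * ?A) $$ (i, j) = 1\<^sub>m n $$ (i, j)" by simp
  then show ?thesis
    using ij by (simp add: scalar_prod_def lessThan_atLeast0)
qed

lemma lin_map_pts: "lin_map n A v \<in> pts n"
  by (simp add: lin_map_def pts_def)

lemma lin_map_lin_map:
  assumes "\<And>i j. i < n \<Longrightarrow> j < n \<Longrightarrow> (\<Sum>m<n. A i m * B m j) = (if i = j then 1 else 0)" and "v \<in> pts n"
  shows "lin_map n A (lin_map n B v) = v"
proof
  fix b
  show "lin_map n A (lin_map n B v) b = v b"
  proof (cases "b < n")
    case True
    have "lin_map n A (lin_map n B v) b = (\<Sum>c<n. (\<Sum>a<n. A b a * B a c) * v c)"
      using True unfolding lin_map_def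
      by (simp add: sum_distrib_left sum_distrib_right mult.assoc) (rule sum.swap)
    also have "\<dots> = v b"
      using True by (simp add: assms(1) if_distrib[of "\<lambda>z. z * _"] cong: if_cong)
    finally show ?thesis .
  next
    case False
    then show ?thesis using assms(2) by (simp add: lin_map_def pts_def)
  qed
qed

section \<open>The null space of the curvature and its orthogonal complement\<close>

context plane_wave
begin

lemma lin_map_ev: "a < N \<Longrightarrow> b < N \<Longrightarrow> lin_map N A (ev a) b = A b a"
  by (simp add: lin_map_def ev_def if_distrib[of "\<lambda>z. _ * z"] cong: if_cong)

lemma curv_form_single:
  assumes "i \<in> I" "\<And>j. j \<in> I \<Longrightarrow> j \<noteq> i \<Longrightarrow> curv_coeff j l x (vs ! 0) (vs ! 1) (vs ! 2) (vs ! 3) = 0"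
  shows "curv_form l x vs = curv_coeff i l x (vs ! 0) (vs ! 1) (vs ! 2) (vs ! 3) * (\<Prod>y\<leftarrow>drop 4 vs. y i)"
  unfolding curv_form_def using assms by (subst sum.remove[of I i]) auto

definition vs_space :: "pt set" where
  "vs_space = {w \<in> pts N. w 0 = 0 \<and> (\<forall>i\<in>I. w i = 0)}"

definition curv_null :: "pt \<Rightarrow> pt \<Rightarrow> bool" where
  "curv_null x n \<longleftrightarrow> (\<forall>a\<in>pts N. \<forall>b\<in>pts N. \<forall>c\<in>pts N. curv_form 0 x [n, a, b, c] = 0)"

lemma curv_null_v: "curv_null x (ev (vx 0))" "i \<in> I \<Longrightarrow> curv_null x (ev (vx i))"
  by (auto simp: curv_null_def curv_form_def curv_coeff_def du0_du_def du_ds_def ev_def)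

text \<open>Coordinate vectors in the other slots isolate one component of \<open>n\<close> at a
  time, with the factor \<open>1 + f1 i\<close>, which admissibility keeps away from 0.\<close>

lemma curv_null_zero:
  assumes n: "curv_null x n" and i: "i \<in> I"
  shows "n 0 = 0" "n i = 0" "n (sx i) = 0"
proof -
  have p_coeff: "p_coeff i 0 (x i) \<noteq> 0" using f1_nz[OF i] by (simp add: p_coeff_def)
  have e: "ev 0 \<in> pts N" "ev i \<in> pts N" "ev (sx i) \<in> pts N"
    using i by (simp_all add: ev_pts)
  have "curv_form 0 x [n, ev i, ev i, ev (sx i)] = p_coeff i 0 (x i) * n 0"
    using i by (subst curv_form_single[OF i]) (auto simp: curv_coeff_def du0_du_def du_ds_def ev_def)
  with n e p_coeff show n0: "n 0 = 0" by (auto simp: curv_null_def)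
  have "curv_form 0 x [n, ev 0, ev i, ev (sx i)] = - p_coeff i 0 (x i) * n i"
    using i by (subst curv_form_single[OF i]) (auto simp: curv_coeff_def du0_du_def du_ds_def ev_def)
  with n e p_coeff show "n i = 0" by (auto simp: curv_null_def)
  \<comment> \<open>This value also contains \<open>h_coeff\<close> times \<open>n 0\<close>, so
    \<open>n 0 = 0\<close> has to be known first.\<close>
  have "curv_form 0 x [n, ev i, ev 0, ev i] = - p_coeff i 0 (x i) * n (sx i)"
    using i n0 by (subst curv_form_single[OF i]) (auto simp: curv_coeff_def du0_du_def du_ds_def ev_def)
  with n e p_coeff show "n (sx i) = 0" by (auto simp: curv_null_def)
qed

text \<open>Null vectors lie in the span of the \<open>v\<close>-directions, which the metric pairs
  with \<open>u\<close>-directions only. The index \<open>1\<close> in \<open>I\<close> yields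
  \<open>n 0 = 0\<close>; for empty \<open>I\<close> every vector would be null.\<close>

lemma gval_vs_space_null:
  assumes "w \<in> vs_space" "curv_null x n" "k \<ge> 1"
  shows "gval N g x w n = 0"
proof -
  have "1 \<in> I" using assms(3) by (simp add: I_def)
  then have "n 0 = 0" by (rule curv_null_zero(1)[OF assms(2)])
  then show ?thesis
    using assms(1) curv_null_zero(2,3)[OF assms(2)] by (simp add: gval_eq vs_space_def)
qed

lemma gval_vs_space:
  assumes "w \<in> vs_space" "w' \<in> vs_space"
  shows "gval N g x w w' = (\<Sum>i\<in>I. eps i * w (sx i) * w' (sx i))"
  using assms by (simp add: gval_eq vs_space_def)

text \<open>On \<open>w\<close> both \<open>du_0\<close> and \<open>du_i\<close> vanish, hence
  \<open>du0_du i c w = 0\<close>; this removes the \<open>h_coeff\<close> term and one of the two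
  products in \<open>curv_coeff\<close>.\<close>

lemma curv_form_vs_space:
  assumes "w \<in> vs_space"
  shows "curv_form l x (a # b # c # w # ys) = (\<Sum>i\<in>I. p_coeff i l (x i) * du0_du i a b * c i * w (sx i) * (\<Prod>y\<leftarrow>ys. y i))"
  unfolding curv_form_def
  by (rule sum.cong) (use assms in \<open>auto simp: vs_space_def curv_coeff_def du0_du_def du_ds_def numeral_eq_Suc\<close>)

lemma curv_form_vs_space_ev:
  assumes "w \<in> vs_space" "i \<in> I"
  shows "curv_form l x (ev 0 # ev i # ev i # w # ys) = p_coeff i l (x i) * w (sx i) * (\<Prod>y\<leftarrow>ys. y i)"
proof -
  have "du0_du j (ev 0) (ev i) = (if j = i then 1 else 0)" if "j \<in> I" for j
    using that assms(2) by (auto simp: du0_du_def ev_def)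
  then show ?thesis
    using assms(2) unfolding curv_form_vs_space[OF assms(1)]
    by (subst sum.remove[of I i]) (auto simp: ev_def intro!: sum.neutral)
qed

lemma ev_s_vs_space: "i \<in> I \<Longrightarrow> ev (sx i) \<in> vs_space"
  by (auto simp: vs_space_def ev_pts) (auto simp: ev_def)

text \<open>For \<open>l \<ge> 1\<close> this is \<open>p_coeff i l * y ^ l / p_coeff i 0\<close>
  with \<open>y = p_coeff i 0 / p_coeff i 1\<close>: the eigenvalue of the endomorphism
  \<open>O\<close> on the \<open>i\<close>-th \<open>s\<close>-direction.\<close>

definition beta_term :: "nat \<Rightarrow> nat \<Rightarrow> pt \<Rightarrow> real" where
  "beta_term i l x = p_coeff i l (x i) * p_coeff i 0 (x i) ^ (l - 1) / p_coeff i 1 (x i) ^ l"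

text \<open>The defining equation of \<open>y\<close> fixes its \<open>u_i\<close>-components for
  \<open>i\<close> in \<open>I\<close>; all others are set to 0.\<close>

definition ystar :: "pt \<Rightarrow> pt" where
  "ystar x = (\<lambda>i. if i \<in> I then p_coeff i 0 (x i) / p_coeff i 1 (x i) else 0)"

lemma ystar_pts: "ystar x \<in> pts N"
  by (auto simp: ystar_def pts_def I_def N_def)

lemma p_coeff_nz: "i \<in> I \<Longrightarrow> p_coeff i 0 u \<noteq> 0" "i \<in> I \<Longrightarrow> p_coeff i 1 u \<noteq> 0"
  using f1_nz f2_nz by (simp_all add: p_coeff_def)

lemma beta_eq: "l \<ge> 1 \<Longrightarrow> beta l F k x = (\<Sum>i\<in>I. beta_term i l x)"
  by (simp add: beta_def beta_term_def p_coeff_def I_def numeral_2_eq_2)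

lemma p_coeff_quot_power:
  assumes "i \<in> I" "l \<ge> 1"
  shows "p_coeff i l (x i) * (p_coeff i 0 (x i) / p_coeff i 1 (x i)) ^ l = beta_term i l x * p_coeff i 0 (x i)"
proof -
  obtain m where "l = Suc m" using assms(2) by (cases l) auto
  then show ?thesis by (simp add: beta_term_def power_divide)
qed

end

section \<open>Comparison of two models with the same signs\<close>

text \<open>Dimension, index sets and coordinate vectors depend at most on \<open>k\<close>, so one
  notation serves both metrics.\<close>

locale wave_pair = P: plane_wave k eps F + Q: plane_wave k eps F'
  for k eps F F'
begin

abbreviation "N \<equiv> P.N"
abbreviation "I \<equiv> P.I"
abbreviation "sx \<equiv> P.sx"
abbreviation "ev \<equiv> P.ev"

text \<open>With Gram matrices \<open>G\<close> and \<open>G'\<close> the hypothesis reads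
  \<open>A^T G' A = G\<close>. Hence \<open>A^T (G' A G^-1) = 1\<close>, and the transpose of the
  matrix \<open>b = G' A G^-1\<close> inverts \<open>A\<close>.\<close>

lemma isometry_inverse:
  assumes isom: "\<And>v w. v \<in> pts N \<Longrightarrow> w \<in> pts N \<Longrightarrow>
      gval N Q.g q (lin_map N A v) (lin_map N A w) = gval N P.g p v w"
  obtains B where "\<And>v. v \<in> pts N \<Longrightarrow> lin_map N A (lin_map N B v) = v"
    "\<And>v. v \<in> pts N \<Longrightarrow> lin_map N B (lin_map N A v) = v"
proof -
  define b where "b m j = (\<Sum>e<N. (\<Sum>d<N. Q.g q m d * A d e) * ginv N P.g p e j)" for m j
  have gA: "(\<Sum>m<N. A m i * (\<Sum>d<N. Q.g q m d * A d e)) = P.g p i e" if ie: "i < N" "e < N" for i e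
  proof -
    have "(\<Sum>m<N. A m i * (\<Sum>d<N. Q.g q m d * A d e)) = gval N Q.g q (lin_map N A (ev i)) (lin_map N A (ev e))"
      using ie by (simp add: gval_def P.lin_map_ev sum_distrib_left mult_ac)
    also have "\<dots> = P.g p i e"
      using ie by (simp add: isom P.ev_pts P.gval_ev P.lower_ev P.g_sym)
    finally show ?thesis .
  qed
  have "(\<Sum>m<N. A m i * b m j) = (if i = j then 1 else 0)" if ij: "i < N" "j < N" for i j
  proof -
    have "(\<Sum>m<N. A m i * b m j) = (\<Sum>e<N. (\<Sum>m<N. A m i * (\<Sum>d<N. Q.g q m d * A d e)) * ginv N P.g p e j)"
      unfolding b_def sum_distrib_left[of "A _ _" _ "{..<N}"] sum_distrib_right[of _ "{..<N}" "ginv N P.g p _ _"]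
      by (subst sum.swap) (simp add: mult.assoc)
    also have "\<dots> = (if i = j then 1 else 0)"
      using ij by (simp add: gA P.ginv_inverse)
    finally show ?thesis .
  qed
  then have *: "(\<Sum>m<N. b i m * A j m) = (if i = j then 1 else 0)" if "i < N" "j < N" for i j
    using left_inverse_right_inverse[of N "\<lambda>i m. A m i" b i j] that by blast
  define B where "B = (\<lambda>m j. b j m)"
  have AB: "(\<Sum>m<N. A i m * B m j) = (if i = j then 1 else 0)" if "i < N" "j < N" for i j
    using *[OF that(2,1)] by (auto simp: B_def mult.commute)
  have BA: "(\<Sum>m<N. B i m * A m j) = (if i = j then 1 else 0)" if "i < N" "j < N" for i j
    using left_inverse_right_inverse[of N A B i j] AB that by blast
  show ?thesis
    by (rule that[of B]) (auto intro: lin_map_lin_map AB BA)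
qed

text \<open>The null space of \<open>R\<close> and its orthogonal complement are determined by the
  model. Null vectors pull back to null vectors under the inverse, and orthogonality to the
  \<open>v\<close>-directions means vanishing \<open>u\<close>-components.\<close>

lemma vs_space_preserved:
  assumes \<Phi>: "\<And>v. \<Phi> v \<in> pts N" and \<Psi>: "\<And>v. \<Psi> v \<in> pts N" and inv: "\<And>v. v \<in> pts N \<Longrightarrow> \<Phi> (\<Psi> v) = v"
    and isom: "\<And>v w. v \<in> pts N \<Longrightarrow> w \<in> pts N \<Longrightarrow> gval N Q.g q (\<Phi> v) (\<Phi> w) = gval N P.g p v w"
    and T: "\<And>vs. length vs = 4 \<Longrightarrow> set vs \<subseteq> pts N \<Longrightarrow> Q.curv_form 0 q (map \<Phi> vs) = P.curv_form 0 p vs"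
    and k: "k \<ge> 1" and w: "w \<in> P.vs_space"
  shows "\<Phi> w \<in> Q.vs_space"
proof -
  have null: "P.curv_null p (\<Psi> n)" if n: "Q.curv_null q n" and "n \<in> pts N" for n
    unfolding P.curv_null_def
  proof (intro ballI)
    fix a b c assume "a \<in> pts N" "b \<in> pts N" "c \<in> pts N"
    then show "P.curv_form 0 p [\<Psi> n, a, b, c] = 0"
      using T[of "[\<Psi> n, a, b, c]"] n \<Phi> \<Psi> inv[OF \<open>n \<in> pts N\<close>] by (simp add: Q.curv_null_def)
  qed
  have orth: "gval N Q.g q (\<Phi> w) n = 0" if n: "Q.curv_null q n" and n': "n \<in> pts N" for n
  proof -
    have "gval N Q.g q (\<Phi> w) n = gval N P.g p w (\<Psi> n)"
      using isom[of w "\<Psi> n"] w \<Psi> inv[OF n'] by (simp add: P.vs_space_def)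
    also have "\<dots> = 0" by (rule P.gval_vs_space_null[OF w null[OF n n'] k])
    finally show ?thesis .
  qed
  have "\<Phi> w 0 = 0"
    using orth[OF Q.curv_null_v(1)] by (simp add: Q.gval_ev Q.ev_pts)
  moreover have "\<Phi> w i = 0" if "i \<in> I" for i
    using orth[OF Q.curv_null_v(2)[OF that]] that by (simp add: Q.gval_ev Q.ev_pts)
  ultimately show ?thesis using \<Phi> by (simp add: Q.vs_space_def)
qed

text \<open>Compares the traces of \<open>O\<close> in the two models. \<open>M\<close> is the
  matrix of the isometry between the quotients of \<open>vs_space\<close> by the
  \<open>v\<close>-directions; it is orthogonal for the form with signs \<open>eps\<close> and
  intertwines the two diagonal endomorphisms.\<close>

lemma beta_invariant:
  assumes k: "k \<ge> 1" and l: "l \<ge> 1"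
    and isom: "\<And>v w. v \<in> pts N \<Longrightarrow> w \<in> pts N \<Longrightarrow>
      gval N Q.g q (lin_map N A v) (lin_map N A w) = gval N P.g p v w"
    and TA: "\<And>i vs. i \<le> l \<Longrightarrow> length vs = 4 + i \<Longrightarrow> set vs \<subseteq> pts N \<Longrightarrow>
      Q.curv_form i q (map (lin_map N A) vs) = P.curv_form i p vs"
  shows "beta l F k p = beta l F' k q"
proof -
  obtain B where AB: "\<And>v. v \<in> pts N \<Longrightarrow> lin_map N A (lin_map N B v) = v"
    and BA: "\<And>v. v \<in> pts N \<Longrightarrow> lin_map N B (lin_map N A v) = v"
    using isometry_inverse[OF isom] by blast
  let ?\<Phi> = "lin_map N A" and ?\<Psi> = "lin_map N B"
  \<comment> \<open>With the roles exchanged, \<open>vs_space_preserved\<close> applies to the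
    inverse map as well.\<close>
  interpret R: wave_pair k eps F' F by unfold_locales
  have isomB: "gval N P.g p (?\<Psi> v) (?\<Psi> w) = gval N Q.g q v w" if "v \<in> pts N" "w \<in> pts N" for v w
    using isom[of "?\<Psi> v" "?\<Psi> w"] that by (simp add: AB lin_map_pts)
  have TB: "P.curv_form i p (map ?\<Psi> vs) = Q.curv_form i q vs" if "i \<le> l" "length vs = 4 + i" "set vs \<subseteq> pts N" for i vs
  proof -
    have "map ?\<Phi> (map ?\<Psi> vs) = vs"
      using that(3) AB by (auto intro!: map_idI)
    moreover have "set (map ?\<Psi> vs) \<subseteq> pts N" using lin_map_pts by auto
    ultimately show ?thesis using TA[of i "map ?\<Psi> vs"] that by simp
  qed
  have W: "?\<Phi> w \<in> Q.vs_space" if "w \<in> P.vs_space" for w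
    using vs_space_preserved[OF lin_map_pts lin_map_pts AB isom TA k that] by simp
  have WB: "?\<Psi> w \<in> P.vs_space" if "w \<in> Q.vs_space" for w
    using R.vs_space_preserved[OF lin_map_pts lin_map_pts BA isomB TB k that] by simp
  note sW = P.ev_s_vs_space Q.ev_s_vs_space
  have pts_s: "ev (sx i) \<in> pts N" "ev i \<in> pts N" "ev 0 \<in> pts N" if "i \<in> I" for i
    using that by (simp_all add: P.ev_pts)
  let ?y = "P.ystar p"
  define M where "M j i = ?\<Phi> (ev (sx i)) (sx j)" for j i
  \<comment> \<open>The image of \<open>ystar p\<close> need not be \<open>ystar q\<close>, but it
    satisfies the same defining equation, and that determines these components.\<close>
  have y: "?\<Phi> ?y j = Q.p_coeff j 0 (q j) / Q.p_coeff j 1 (q j)" if j: "j \<in> I" for j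
  proof -
    note e = pts_s[OF j]
    have w: "?\<Psi> (ev (sx j)) \<in> P.vs_space" using WB sW(2) j by blast
    have "Q.p_coeff j 1 (q j) * ?\<Phi> ?y j = Q.curv_form 1 q [ev 0, ev j, ev j, ev (sx j), ?\<Phi> ?y]"
      using Q.curv_form_vs_space_ev[OF sW(2)[OF j] j, of 1 q "[?\<Phi> ?y]"] by (simp add: P.ev_def)
    also have "\<dots> = P.curv_form 1 p [?\<Psi> (ev 0), ?\<Psi> (ev j), ?\<Psi> (ev j), ?\<Psi> (ev (sx j)), ?y]"
      using TA[of 1 "[?\<Psi> (ev 0), ?\<Psi> (ev j), ?\<Psi> (ev j), ?\<Psi> (ev (sx j)), ?y]"] l e
      by (simp add: AB lin_map_pts P.ystar_pts)
    \<comment> \<open>In the extra slot \<open>ystar p\<close> multiplies \<open>p_coeff i 1\<close>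
      into \<open>p_coeff i 0\<close>, so \<nabla>R becomes R.\<close>
    also have "\<dots> = P.curv_form 0 p [?\<Psi> (ev 0), ?\<Psi> (ev j), ?\<Psi> (ev j), ?\<Psi> (ev (sx j))]"
      unfolding P.curv_form_vs_space[OF w] using P.p_coeff_nz(2) by (auto simp: P.ystar_def intro!: sum.cong)
    also have "\<dots> = Q.curv_form 0 q [ev 0, ev j, ev j, ev (sx j)]"
      using TB[of 0 "[ev 0, ev j, ev j, ev (sx j)]"] e by simp
    also have "\<dots> = Q.p_coeff j 0 (q j)"
      using Q.curv_form_vs_space_ev[OF sW(2)[OF j] j, of 0 q "[]"] by (simp add: P.ev_def)
    finally show ?thesis using Q.p_coeff_nz(2)[OF j] by (simp add: field_simps)
  qed
  \<comment> \<open>The entry \<open>(j, i)\<close> of the intertwining relation: the tensor with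
    \<open>l\<close> copies of \<open>y\<close> is \<open>R\<close> with \<open>O\<close> applied to
    the fourth argument, evaluated in both models.\<close>
  have eig: "Q.beta_term j l q * M j i = P.beta_term i l p * M j i" if i: "i \<in> I" and j: "j \<in> I" for i j
  proof -
    note e = pts_s[OF i] pts_s[OF j]
    let ?w = "ev (sx i)" and ?a = "?\<Psi> (ev 0)" and ?b = "?\<Psi> (ev j)"
    have w: "?\<Phi> ?w \<in> Q.vs_space" using W sW(1) i by blast
    have "Q.beta_term j l q * Q.p_coeff j 0 (q j) * M j i = Q.curv_form l q (ev 0 # ev j # ev j # ?\<Phi> ?w # replicate l (?\<Phi> ?y))"
      by (simp add: Q.curv_form_vs_space_ev[OF w j] y[OF j] M_def Q.p_coeff_quot_power[OF j l, symmetric])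
    also have "\<dots> = P.curv_form l p (?a # ?b # ?b # ?w # replicate l ?y)"
      using TA[of l "?a # ?b # ?b # ?w # replicate l ?y"] e
      by (simp add: AB lin_map_pts P.ystar_pts set_replicate_conv_if)
    also have "\<dots> = P.beta_term i l p * P.curv_form 0 p [?a, ?b, ?b, ?w]"
    proof -
      \<comment> \<open>Only \<open>m = i\<close> contributes, since \<open>?w\<close> has a single
        nonzero \<open>s\<close>-component; this allows the eigenvalue with the fixed index
        \<open>i\<close> to be factored out.\<close>
      have eq: "P.p_coeff m l (p m) * x * z * ?w (sx m) * (\<Prod>y\<leftarrow>replicate l ?y. y m)
         = P.beta_term i l p * (P.p_coeff m 0 (p m) * x * z * ?w (sx m))" if m: "m \<in> I" for m x z
      proof (cases "m = i")
        case True
        then show ?thesis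
          using P.p_coeff_quot_power[OF m l, of p] m by (simp add: P.ystar_def)
      qed (simp add: P.ev_def)
      show ?thesis
        unfolding P.curv_form_vs_space[OF sW(1)[OF i]] sum_distrib_left
        by (rule sum.cong[OF refl]) (simp only: eq list.map(1) prod_list.Nil mult_1_right)
    qed
    also have "P.curv_form 0 p [?a, ?b, ?b, ?w] = Q.curv_form 0 q [ev 0, ev j, ev j, ?\<Phi> ?w]"
      using TA[of 0 "[?a, ?b, ?b, ?w]"] e by (simp add: AB lin_map_pts)
    also have "\<dots> = Q.p_coeff j 0 (q j) * M j i"
      using Q.curv_form_vs_space_ev[OF w j, of 0 q "[]"] by (simp add: M_def)
    finally show ?thesis using Q.p_coeff_nz(1)[OF j] by simp
  qed
  have col: "(\<Sum>j\<in>I. eps j * (M j i * M j i)) = eps i" if i: "i \<in> I" for i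
  proof -
    have "(\<Sum>j\<in>I. eps j * (M j i * M j i)) = gval N Q.g q (?\<Phi> (ev (sx i))) (?\<Phi> (ev (sx i)))"
      using W sW(1)[OF i] by (simp add: Q.gval_vs_space M_def mult.assoc)
    also have "\<dots> = gval N P.g p (ev (sx i)) (ev (sx i))"
      using isom pts_s[OF i] by simp
    also have "\<dots> = eps i"
      using i by (simp add: P.gval_ev) (simp add: P.ev_def)
    finally show ?thesis .
  qed
  \<comment> \<open>By \<open>s\<close> the inverse has the entries
    \<open>eps i * eps j * M j i\<close>, so the norm of the preimage of the \<open>j\<close>-th
    \<open>s\<close>-direction is a sum over row \<open>j\<close> of \<open>M\<close>.\<close>
  have row: "(\<Sum>i\<in>I. eps i * (M j i * M j i)) = eps j" if j: "j \<in> I" for j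
  proof -
    have s: "?\<Psi> (ev (sx j)) (sx i) * eps i = eps j * M j i" if i: "i \<in> I" for i
    proof -
      have "?\<Psi> (ev (sx j)) (sx i) * eps i = gval N P.g p (?\<Psi> (ev (sx j))) (ev (sx i))"
        using i by (simp add: P.gval_ev mult.commute)
      also have "\<dots> = gval N Q.g q (ev (sx j)) (?\<Phi> (ev (sx i)))"
        using isom[of "?\<Psi> (ev (sx j))" "ev (sx i)"] pts_s[OF i] pts_s[OF j] by (simp add: AB lin_map_pts)
      also have "\<dots> = eps j * M j i"
        using j by (subst Q.gval_sym) (simp add: Q.gval_ev M_def)
      finally show ?thesis .
    qed
    have "(\<Sum>i\<in>I. eps i * (M j i * M j i)) = (\<Sum>i\<in>I. eps i * ?\<Psi> (ev (sx j)) (sx i) * ?\<Psi> (ev (sx j)) (sx i))"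
    proof (rule sum.cong)
      fix i assume i: "i \<in> I"
      have "eps i * (M j i * M j i) = eps i * ((eps j * M j i) * (eps j * M j i))"
        using P.eps_pm[of j] j by (auto simp: P.I_def)
      also have "\<dots> = eps i * ?\<Psi> (ev (sx j)) (sx i) * ?\<Psi> (ev (sx j)) (sx i)"
        unfolding s[OF i, symmetric] using P.eps_pm[of i] i by (auto simp: P.I_def)
      finally show "eps i * (M j i * M j i) = eps i * ?\<Psi> (ev (sx j)) (sx i) * ?\<Psi> (ev (sx j)) (sx i)" .
    qed simp
    also have "\<dots> = gval N P.g p (?\<Psi> (ev (sx j))) (?\<Psi> (ev (sx j)))"
      using WB sW(2)[OF j] by (simp add: P.gval_vs_space)
    also have "\<dots> = gval N Q.g q (ev (sx j)) (ev (sx j))"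
      using isomB pts_s[OF j] by simp
    also have "\<dots> = eps j"
      using j by (simp add: Q.gval_ev) (simp add: P.ev_def)
    finally show ?thesis .
  qed
  \<comment> \<open>The column relation inserts a factor 1, \<open>eig\<close> exchanges the
    eigenvalues under the double sum, and the row relation removes the factor again.\<close>
  have "(\<Sum>i\<in>I. P.beta_term i l p) = (\<Sum>i\<in>I. \<Sum>j\<in>I. eps i * eps j * M j i * (P.beta_term i l p * M j i))"
  proof (rule sum.cong)
    fix i assume i: "i \<in> I"
    have "P.beta_term i l p = P.beta_term i l p * eps i * (\<Sum>j\<in>I. eps j * (M j i * M j i))"
      using col[OF i] P.eps_sq[OF i] by (simp add: mult.assoc)
    then show "P.beta_term i l p = (\<Sum>j\<in>I. eps i * eps j * M j i * (P.beta_term i l p * M j i))"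
      by (simp add: sum_distrib_left mult_ac)
  qed simp
  also have "\<dots> = (\<Sum>i\<in>I. \<Sum>j\<in>I. eps i * eps j * M j i * (Q.beta_term j l q * M j i))"
    by (intro sum.cong refl) (simp add: eig)
  also have "\<dots> = (\<Sum>j\<in>I. \<Sum>i\<in>I. eps i * eps j * M j i * (Q.beta_term j l q * M j i))"
    by (rule sum.swap)
  also have "\<dots> = (\<Sum>j\<in>I. Q.beta_term j l q)"
  proof (rule sum.cong)
    fix j assume j: "j \<in> I"
    have "Q.beta_term j l q = Q.beta_term j l q * eps j * (\<Sum>i\<in>I. eps i * (M j i * M j i))"
      using row[OF j] P.eps_sq[OF j] by (simp add: mult.assoc)
    then show "(\<Sum>i\<in>I. eps i * eps j * M j i * (Q.beta_term j l q * M j i)) = Q.beta_term j l q"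
      by (simp add: sum_distrib_left mult_ac)
  qed simp
  finally show ?thesis using l by (simp add: P.beta_eq Q.beta_eq)
qed

lemma model_iso_beta:
  assumes "k \<ge> 1" "l \<ge> 1" "model_iso N P.g p Q.g q A l"
  shows "beta l F k p = beta l F' k q"
  using assms(3) unfolding model_iso_def
  by (intro beta_invariant[OF assms(1,2), of q A p]) (simp_all add: P.tensor_at_curv_form Q.tensor_at_curv_form)

end

section \<open>Local isometries\<close>

text \<open>The mean value theorem is applied in \<open>s\<close> to the difference of
  \<open>H\<close> at heights \<open>r\<close> and \<open>0\<close>, and then in \<open>t\<close> to
  \<open>Hs\<close>.\<close>

lemma double_mvt:
  fixes H :: "real \<Rightarrow> real \<Rightarrow> real"
  assumes "0 < r"
    and H1: "\<And>s t. 0 \<le> s \<Longrightarrow> s \<le> r \<Longrightarrow> 0 \<le> t \<Longrightarrow> t \<le> r \<Longrightarrow> ((\<lambda>s. H s t) has_real_derivative Hs s t) (at s)"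
    and H12: "\<And>s t. 0 \<le> s \<Longrightarrow> s \<le> r \<Longrightarrow> 0 \<le> t \<Longrightarrow> t \<le> r \<Longrightarrow> ((\<lambda>t. Hs s t) has_real_derivative Hst s t) (at t)"
  shows "\<exists>\<xi> \<eta>. 0 < \<xi> \<and> \<xi> < r \<and> 0 < \<eta> \<and> \<eta> < r \<and> H r r - H r 0 - H 0 r + H 0 0 = r * r * Hst \<xi> \<eta>"
proof -
  have D: "((\<lambda>s. H s r - H s 0) has_real_derivative Hs s r - Hs s 0) (at s)" if "0 \<le> s" "s \<le> r" for s
    using H1[OF that] \<open>0 < r\<close> by (auto intro!: DERIV_diff)
  obtain \<xi> where \<xi>: "0 < \<xi>" "\<xi> < r" "(H r r - H r 0) - (H 0 r - H 0 0) = (r - 0) * (Hs \<xi> r - Hs \<xi> 0)"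
    using MVT2[OF \<open>0 < r\<close> D] by blast
  obtain \<eta> where "0 < \<eta>" "\<eta> < r" "Hs \<xi> r - Hs \<xi> 0 = (r - 0) * Hst \<xi> \<eta>"
    using MVT2[OF \<open>0 < r\<close>, of "Hs \<xi>" "Hst \<xi>"] H12 \<xi> by auto
  with \<xi> show ?thesis by (intro exI[of _ \<xi>] exI[of _ \<eta>]) (auto simp: algebra_simps)
qed

text \<open>One and the same second difference equals \<open>r * r\<close> times a value of either
  mixed partial near the origin; for small \<open>r\<close>, continuity excludes different
  limits.\<close>

lemma mixed_partials_eq:
  fixes H :: "real \<Rightarrow> real \<Rightarrow> real"
  assumes "0 < d"
    and H1: "\<And>s t. \<bar>s\<bar> < d \<Longrightarrow> \<bar>t\<bar> < d \<Longrightarrow> ((\<lambda>s. H s t) has_real_derivative Hs s t) (at s)"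
    and H2: "\<And>s t. \<bar>s\<bar> < d \<Longrightarrow> \<bar>t\<bar> < d \<Longrightarrow> ((\<lambda>t. H s t) has_real_derivative Ht s t) (at t)"
    and H12: "\<And>s t. \<bar>s\<bar> < d \<Longrightarrow> \<bar>t\<bar> < d \<Longrightarrow> ((\<lambda>t. Hs s t) has_real_derivative Hst s t) (at t)"
    and H21: "\<And>s t. \<bar>s\<bar> < d \<Longrightarrow> \<bar>t\<bar> < d \<Longrightarrow> ((\<lambda>s. Ht s t) has_real_derivative Hts s t) (at s)"
    and c1: "isCont (\<lambda>(s, t). Hst s t) (0, 0)" and c2: "isCont (\<lambda>(s, t). Hts s t) (0, 0)"
  shows "Hst 0 0 = Hts 0 0"
proof (rule ccontr)
  assume ne: "Hst 0 0 \<noteq> Hts 0 0"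
  define e where "e = \<bar>Hst 0 0 - Hts 0 0\<bar> / 2"
  have "e > 0" using ne by (simp add: e_def)
  then obtain d1 d2 where d1: "d1 > 0" "\<And>s t. dist (s, t) (0, 0) < d1 \<Longrightarrow> dist (Hst s t) (Hst 0 0) < e"
    and d2: "d2 > 0" "\<And>s t. dist (s, t) (0, 0) < d2 \<Longrightarrow> dist (Hts s t) (Hts 0 0) < e"
    using c1 c2 unfolding continuous_at_eps_delta by force
  \<comment> \<open>The halving matters because points of the square of side \<open>r\<close> are
    only known to lie within \<open>2 * r\<close> of the origin.\<close>
  define r where "r = min (d / 2) (min (d1 / 2) (d2 / 2))"
  have r: "0 < r" "r < d" "2 * r \<le> d1" "2 * r \<le> d2"
    using \<open>0 < d\<close> d1(1) d2(1) by (auto simp: r_def)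
  have near: "dist (s, t) (0, 0) < 2 * r" if "0 < s" "s < r" "0 < t" "t < r" for s t :: real
  proof -
    have "dist (s, t) (0, 0) \<le> \<bar>s\<bar> + \<bar>t\<bar>"
      by (simp add: dist_Pair_Pair dist_real_def sqrt_sum_squares_le_sum_abs)
    with that show ?thesis by simp
  qed
  obtain a b where ab: "0 < a" "a < r" "0 < b" "b < r" "H r r - H r 0 - H 0 r + H 0 0 = r * r * Hst a b"
    using double_mvt[of r H Hs Hst] H1 H12 r by auto
  obtain a' b' where ab': "0 < a'" "a' < r" "0 < b'" "b' < r" "H r r - H 0 r - H r 0 + H 0 0 = r * r * Hts b' a'"
    using double_mvt[of r "\<lambda>t s. H s t" "\<lambda>t s. Ht s t" "\<lambda>t s. Hts s t"] H2 H21 r by auto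
  have "r * r * Hst a b = r * r * Hts b' a'" using ab(5) ab'(5) by linarith
  then have eq: "Hst a b = Hts b' a'" using r(1) by simp
  have "dist (a, b) (0, 0) < d1" "dist (b', a') (0, 0) < d2"
    using near ab ab' r by (smt (verit))+
  then have "dist (Hst a b) (Hst 0 0) < e" "dist (Hts b' a') (Hts 0 0) < e"
    using d1(2) d2(2) by blast+
  then show False using eq unfolding e_def dist_real_def by (smt (verit) field_sum_of_halves)
qed

text \<open>The last index of the list acts first. Appending an index thus differentiates the
  function itself, which is how \<open>smooth_on\<close> passes to partial derivatives.\<close>

lemma pd_iter_append: "pd_iter (is @ [a]) h = pd_iter is (pd h a)"
  by (induction "is") auto

lemma smooth_on_pd:
  assumes "smooth_on N U h" "a < N"
  shows "smooth_on N U (pd h a)"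
  using assms unfolding smooth_on_def pd_iter_append[symmetric] by auto

lemma smooth_on_continuous: "smooth_on N U h \<Longrightarrow> continuous_on U h"
  unfolding smooth_on_def by (metis empty_iff list.set(1) pd_iter.simps(1) subsetI)

lemma smooth_on_DERIV:
  assumes "smooth_on N U h" "x \<in> U" "a < N"
  shows "((\<lambda>t. h (x(a := x a + t))) has_real_derivative pd h a x) (at 0)"
proof -
  have "(\<lambda>t. h (x(a := x a + t))) differentiable (at 0)"
    using assms unfolding smooth_on_def by (metis empty_iff list.set(1) pd_iter.simps(1) subsetI)
  then show ?thesis
    unfolding pd_def using DERIV_deriv_iff_real_differentiable by blast
qed

text \<open>Points carry the product topology, so coordinatewise continuity of \<open>z\<close>
  suffices; values in \<open>pts N\<close> turn relative openness into openness of the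
  preimage.\<close>

lemma open_preimage_U:
  fixes z :: "'a::topological_space \<Rightarrow> pt"
  assumes U: "openin (top_of_set (pts N)) U" and z: "\<And>m. continuous_on UNIV (\<lambda>p. z p m)"
    and zN: "\<And>p. z p \<in> pts N"
  shows "open {p. z p \<in> U}"
proof -
  obtain S where S: "open S" "U = pts N \<inter> S" using U by (auto simp: openin_open)
  have "continuous_on UNIV z" using z by (rule continuous_on_coordinatewise_then_product)
  then have "open (z -` S)" using S(1) by (simp add: open_vimage)
  moreover have "{p. z p \<in> U} = z -` S" using S(2) zN by auto
  ultimately show ?thesis by simp
qed

text \<open>Restriction to the coordinate plane through \<open>x\<close> reduces the claim to two
  real variables; a small square of that plane stays in \<open>U\<close>.\<close>

lemma pd_commute:
  assumes U: "openin (top_of_set (pts N)) U" and h: "smooth_on N U h" and x: "x \<in> U" and ab: "a < N" "b < N"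
  shows "pd (pd h a) b x = pd (pd h b) a x"
proof (cases "a = b")
  case False
  define z where "z = (\<lambda>s t. x(a := x a + s, b := x b + t))"
  have xN: "x \<in> pts N" using U x openin_imp_subset by blast
  have cz: "continuous_on UNIV (\<lambda>p. (case p of (s, t) \<Rightarrow> z s t) m)" for m
    by (cases "m = b"; cases "m = a") (auto simp: z_def split_beta intro!: continuous_intros)
  have opn: "open {p. (case p of (s, t) \<Rightarrow> z s t) \<in> U}"
    by (rule open_preimage_U[OF U cz]) (use xN ab in \<open>auto simp: z_def pts_def\<close>)
  have z0: "z 0 0 = x" by (simp add: z_def)
  obtain e where e: "e > 0" "ball (0, 0) e \<subseteq> {p. (case p of (s, t) \<Rightarrow> z s t) \<in> U}"
    using opn x z0 openE[OF opn, of "(0, 0)"] by auto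
  have zU: "z s t \<in> U" if "\<bar>s\<bar> < e / 2" "\<bar>t\<bar> < e / 2" for s t
  proof -
    have "dist (0, 0) (s, t) \<le> \<bar>s\<bar> + \<bar>t\<bar>"
      by (simp add: dist_Pair_Pair dist_real_def sqrt_sum_squares_le_sum_abs)
    then have "(s, t) \<in> ball (0, 0) e" using that by simp
    then show ?thesis using e(2) by auto
  qed
  have Da: "((\<lambda>s. f (z s t)) has_real_derivative pd f a (z s t)) (at s)"
    if "smooth_on N U f" "z s t \<in> U" for f s t
  proof -
    have "(\<lambda>\<tau>. f ((z s t)(a := z s t a + \<tau>))) = (\<lambda>\<tau>. f (z (\<tau> + s) t))"
      using False by (intro ext arg_cong[where f = f]) (auto simp: z_def)
    then show ?thesis
      using smooth_on_DERIV[OF that ab(1)] DERIV_shift[of "\<lambda>s. f (z s t)" _ 0 s] by simp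
  qed
  have Db: "((\<lambda>t. f (z s t)) has_real_derivative pd f b (z s t)) (at t)"
    if "smooth_on N U f" "z s t \<in> U" for f s t
  proof -
    have "(\<lambda>\<tau>. f ((z s t)(b := z s t b + \<tau>))) = (\<lambda>\<tau>. f (z s (\<tau> + t)))"
      using False by (intro ext arg_cong[where f = f]) (auto simp: z_def)
    then show ?thesis
      using smooth_on_DERIV[OF that ab(2)] DERIV_shift[of "\<lambda>t. f (z s t)" _ 0 t] by simp
  qed
  have cont: "isCont (\<lambda>(s, t). f (z s t)) (0, 0)" if "smooth_on N U f" for f
  proof -
    have "continuous_on UNIV (\<lambda>p. case p of (s, t) \<Rightarrow> z s t)"
      using cz by (rule continuous_on_coordinatewise_then_product)
    then have "continuous_on {p. (case p of (s, t) \<Rightarrow> z s t) \<in> U} (\<lambda>p. f (case p of (s, t) \<Rightarrow> z s t))"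
      by (intro continuous_on_compose2[OF smooth_on_continuous[OF that]]) (auto intro: continuous_on_subset)
    then have "isCont (\<lambda>p. f (case p of (s, t) \<Rightarrow> z s t)) (0, 0)"
      using opn x z0 by (simp add: continuous_on_eq_continuous_at)
    then show ?thesis by (simp add: case_prod_unfold)
  qed
  note ha = smooth_on_pd[OF h ab(1)] and hb = smooth_on_pd[OF h ab(2)]
  have "pd (pd h a) b (z 0 0) = pd (pd h b) a (z 0 0)"
    by (rule mixed_partials_eq[of "e / 2" "\<lambda>s t. h (z s t)" "\<lambda>s t. pd h a (z s t)" "\<lambda>s t. pd h b (z s t)"])
      (use e(1) zU Da Db h ha hb cont smooth_on_pd ab in auto)
  then show ?thesis by (simp add: z0)
qed simp

context plane_wave
begin

lemma curv_form_slot_lin: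
  assumes "length vs = 4 + l" "j < 4 + l"
  shows "curv_form l x (vs[j := \<lambda>m. v m + z * v' m]) = curv_form l x (vs[j := v]) + z * curv_form l x (vs[j := v'])"
proof -
  obtain v1 v2 v3 v4 ys where vs: "vs = v1 # v2 # v3 # v4 # ys" and ys: "length ys = l"
    using assms(1) by (auto simp: length_Suc_conv numeral_eq_Suc)
  have prod: "prod_list ((map (\<lambda>y. y i) ys)[n := a + z * b])
     = prod_list ((map (\<lambda>y. y i) ys)[n := a]) + z * prod_list ((map (\<lambda>y. y i) ys)[n := b])"
    if "n < l" for n a b i
    using that ys by (simp add: upd_conv_take_nth_drop algebra_simps)
  consider "j = 0" | "j = Suc 0" | "j = Suc (Suc 0)" | "j = Suc (Suc (Suc 0))"
    | n where "j = Suc (Suc (Suc (Suc n)))" "n < l"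
    using assms(2) by (cases j rule: nat.exhaust) (auto simp: numeral_eq_Suc less_Suc_eq_0_disj)
  then show ?thesis
    unfolding curv_form_def sum_distrib_left sum.distrib[symmetric]
  proof cases
    case 5
    then show "(\<Sum>i\<in>I. curv_coeff i l x (vs[j := \<lambda>m. v m + z * v' m] ! 0) (vs[j := \<lambda>m. v m + z * v' m] ! 1)
        (vs[j := \<lambda>m. v m + z * v' m] ! 2) (vs[j := \<lambda>m. v m + z * v' m] ! 3)
        * (\<Prod>y\<leftarrow>drop 4 (vs[j := \<lambda>m. v m + z * v' m]). y i)) =
      (\<Sum>i\<in>I. curv_coeff i l x (vs[j := v] ! 0) (vs[j := v] ! 1) (vs[j := v] ! 2) (vs[j := v] ! 3) * (\<Prod>y\<leftarrow>drop 4 (vs[j := v]). y i)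
       + z * (curv_coeff i l x (vs[j := v'] ! 0) (vs[j := v'] ! 1) (vs[j := v'] ! 2) (vs[j := v'] ! 3) * (\<Prod>y\<leftarrow>drop 4 (vs[j := v']). y i)))"
      by (intro sum.cong refl) (simp add: vs numeral_eq_Suc map_update prod algebra_simps)
  qed (intro sum.cong refl; simp add: vs numeral_eq_Suc curv_coeff_def du0_du_def du_ds_def algebra_simps)+
qed

lemma curv_form_slot_sum:
  assumes "length vs = 4 + l" "j < 4 + l"
  shows "curv_form l x (vs[j := \<lambda>m. \<Sum>a\<in>S. z a * v a m]) = (\<Sum>a\<in>S. z a * curv_form l x (vs[j := v a]))"
proof -
  have zero: "curv_form l x (vs[j := \<lambda>m. 0]) = 0"
    using curv_form_slot_lin[OF assms, of x "\<lambda>m. 0" 1 "\<lambda>m. 0"] by simp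
  show ?thesis
  proof (induction S rule: infinite_finite_induct)
    case (insert a S)
    then show ?case
      using curv_form_slot_lin[OF assms, of x "\<lambda>m. \<Sum>a\<in>S. z a * v a m" "z a" "v a"]
      by (simp add: add.commute)
  qed (simp_all add: zero)
qed

lemma gval_sum_right:
  "gval N g x v (\<lambda>m. \<Sum>a\<in>S. z a * w a m) = (\<Sum>a\<in>S. z a * gval N g x v (w a))"
proof -
  have "gval N g x v (\<lambda>m. \<Sum>a\<in>S. z a * w a m) = (\<Sum>c<N. \<Sum>b<N. \<Sum>a\<in>S. z a * (g x c b * v c * w a b))"
    unfolding gval_def sum_distrib_left by (simp add: mult_ac)
  also have "\<dots> = (\<Sum>a\<in>S. \<Sum>c<N. \<Sum>b<N. z a * (g x c b * v c * w a b))"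
    by (subst (2) sum.swap, subst sum.swap) (rule refl)
  finally show ?thesis by (simp add: gval_def sum_distrib_left)
qed

lemma riem_pts: "riem x u v w \<in> pts N"
  by (simp add: pts_def riem_def dchrist_def)

lemma pts_expand: "v \<in> pts N \<Longrightarrow> (\<lambda>m. \<Sum>a<N. v a * ev a m) = v"
proof
  fix m assume v: "v \<in> pts N"
  show "(\<Sum>a<N. v a * ev a m) = v m"
  proof (cases "m < N")
    case False
    then show ?thesis using v by (auto simp: ev_def pts_def intro!: sum.neutral)
  qed (simp add: ev_expand)
qed

end

section \<open>Transformation laws under a local isometry\<close>

locale wave_isometry = plane_wave +
  fixes U V \<phi>
  assumes isom: "loc_isom N g U V \<phi>"
begin

definition dphi :: "pt \<Rightarrow> nat \<Rightarrow> pt" where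
  "dphi x a = (\<lambda>m. if m < N then pd (\<lambda>y. \<phi> y m) a x else 0)"

definition hess :: "pt \<Rightarrow> nat \<Rightarrow> nat \<Rightarrow> pt" where
  "hess x a b = (\<lambda>m. if m < N then pd (pd (\<lambda>y. \<phi> y m) b) a x else 0)"

definition third :: "pt \<Rightarrow> nat \<Rightarrow> nat \<Rightarrow> nat \<Rightarrow> pt" where
  "third x d a b = (\<lambda>m. if m < N then pd (pd (pd (\<lambda>y. \<phi> y m) b) a) d x else 0)"

abbreviation "D x \<equiv> dmap N \<phi> x"

lemma U_open: "openin (top_of_set (pts N)) U"
  and smooth: "m < N \<Longrightarrow> smooth_on N U (\<lambda>y. \<phi> y m)"
  and D_isom: "x \<in> U \<Longrightarrow> v \<in> pts N \<Longrightarrow> w \<in> pts N \<Longrightarrow>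
     gval N g (\<phi> x) (D x v) (D x w) = gval N g x v w"
  using isom by (auto simp: loc_isom_def)

lemma D_eq: "D x v = (\<lambda>m. \<Sum>a<N. v a * dphi x a m)"
  by (auto simp: dmap_def dphi_def mult.commute)

lemma D_ev: "a < N \<Longrightarrow> D x (ev a) = dphi x a"
  unfolding D_eq by (simp add: ev_def if_distrib[of "\<lambda>z. z * _"] cong: if_cong)

lemma D_lin_map: "D x v = lin_map N (\<lambda>b a. pd (\<lambda>y. \<phi> y b) a x) v"
  by (simp add: dmap_def lin_map_def)

lemma hess_sym: "x \<in> U \<Longrightarrow> a < N \<Longrightarrow> b < N \<Longrightarrow> hess x a b = hess x b a"
  using pd_commute[OF U_open smooth] by (auto simp: hess_def)

lemma third_sym: "x \<in> U \<Longrightarrow> a < N \<Longrightarrow> b < N \<Longrightarrow> d < N \<Longrightarrow> third x d a b = third x a d b"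
  using pd_commute[OF U_open smooth_on_pd[OF smooth]] by (auto simp: third_def)

lemma
  assumes "x \<in> U" "d < N" "m < N"
  shows \<phi>_DERIV: "((\<lambda>t. \<phi> (x(d := x d + t)) m) has_real_derivative dphi x d m) (at 0)"
    and dphi_DERIV: "a < N \<Longrightarrow> ((\<lambda>t. dphi (x(d := x d + t)) a m) has_real_derivative hess x d a m) (at 0)"
    and hess_DERIV: "a < N \<Longrightarrow> b < N \<Longrightarrow> ((\<lambda>t. hess (x(d := x d + t)) a b m) has_real_derivative third x d a b m) (at 0)"
  using smooth_on_DERIV[OF smooth[OF assms(3)] assms(1,2)]
    smooth_on_DERIV[OF smooth_on_pd[OF smooth[OF assms(3)]] assms(1,2)]
    smooth_on_DERIV[OF smooth_on_pd[OF smooth_on_pd[OF smooth[OF assms(3)]]] assms(1,2)] assms(3)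
  by (simp_all add: dphi_def hess_def third_def)

lemma shift_DERIV: "((\<lambda>t. (x(d := x d + t)) m) has_real_derivative ev d m) (at 0)"
  using DERIV_coord_shift[of x d m] by (simp add: ev_def)

lemma shift_in_U:
  assumes "x \<in> U" "d < N"
  shows "\<forall>\<^sub>F t in nhds 0. x(d := x d + t) \<in> U"
proof -
  have "x \<in> pts N" using U_open assms(1) openin_imp_subset by blast
  moreover have "continuous_on UNIV (\<lambda>t. (x(d := x d + t)) m)" for m
    by (cases "m = d") (auto intro!: continuous_intros)
  ultimately have "open {t. x(d := x d + t) \<in> U}"
    using assms(2) by (intro open_preimage_U[OF U_open]) (auto simp: pts_def)
  then show ?thesis using assms(1) by (auto simp: eventually_nhds)
qed

text \<open>An identity on \<open>U\<close> may be differentiated in each coordinate direction,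
  since the coordinate line stays in \<open>U\<close> for small \<open>t\<close>.\<close>

lemma DERIV_eq_near:
  assumes "x \<in> U" "d < N" "\<And>y. y \<in> U \<Longrightarrow> f y = h y"
    and "((\<lambda>t. f (x(d := x d + t))) has_real_derivative a) (at 0)"
    and "((\<lambda>t. h (x(d := x d + t))) has_real_derivative b) (at 0)"
  shows "a = b"
proof -
  have "\<forall>\<^sub>F t in nhds 0. f (x(d := x d + t)) = h (x(d := x d + t))"
    using shift_in_U[OF assms(1,2)] by eventually_elim (rule assms(3))
  from DERIV_cong_ev[OF refl this refl] assms(4,5) show ?thesis
    using DERIV_unique by blast
qed

lemma metric_law:
  assumes x: "x \<in> U" and dab: "d < N" "a < N" "b < N"
  shows "dmetric (\<phi> x) (dphi x d) (dphi x a) (dphi x b) + gval N g (\<phi> x) (hess x d a) (dphi x b)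
     + gval N g (\<phi> x) (dphi x a) (hess x d b) = dmetric x (ev d) (ev a) (ev b)"
proof -
  have "dmetric (\<phi> (x(d := x d + 0))) (dphi x d) (dphi (x(d := x d + 0)) a) (dphi (x(d := x d + 0)) b)
     + gval N g (\<phi> (x(d := x d + 0))) (hess x d a) (dphi (x(d := x d + 0)) b)
     + gval N g (\<phi> (x(d := x d + 0))) (dphi (x(d := x d + 0)) a) (hess x d b)
    = dmetric (x(d := x d + 0)) (ev d) (ev a) (ev b) + gval N g (x(d := x d + 0)) (\<lambda>_. 0) (ev b)
       + gval N g (x(d := x d + 0)) (ev a) (\<lambda>_. 0)"
  proof (rule DERIV_eq_near[OF x dab(1)])
    show "gval N g (\<phi> y) (dphi y a) (dphi y b) = gval N g y (ev a) (ev b)" if "y \<in> U" for y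
      using D_isom[OF that ev_pts ev_pts] dab by (simp add: D_ev)
  qed (rule gval_DERIV; use \<phi>_DERIV dphi_DERIV shift_DERIV x dab in simp)+
  then show ?thesis by (simp add: gval_def)
qed

lemma D_surj:
  assumes "x \<in> U" "w \<in> pts N"
  obtains v where "v \<in> pts N" "D x v = w"
proof -
  interpret W: wave_pair k eps F F by unfold_locales
  let ?A = "\<lambda>b a. pd (\<lambda>y. \<phi> y b) a x"
  have iso: "gval N g (\<phi> x) (lin_map N ?A v) (lin_map N ?A w) = gval N g x v w" if "v \<in> pts N" "w \<in> pts N" for v w
    using D_isom[OF assms(1) that] by (simp add: D_lin_map)
  show ?thesis
  proof (rule W.isometry_inverse[OF iso])
    fix B assume "\<And>v. v \<in> pts N \<Longrightarrow> lin_map N ?A (lin_map N B v) = v"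
    then show ?thesis using that[of "lin_map N B w"] assms(2) by (simp add: D_lin_map lin_map_pts)
  qed
qed

text \<open>The sum of \<open>metric_law\<close> for \<open>(d, a, b)\<close> and
  \<open>(a, d, b)\<close> minus that for \<open>(b, d, a)\<close> keeps a single second derivative
  of \<phi> and the two Koszul expressions. The vectors \<open>dphi x b\<close> span, so
  nondegeneracy concludes.\<close>

lemma christ_law:
  assumes x: "x \<in> U" and da: "d < N" "a < N" and m: "m < N"
  shows "christ (\<phi> x) (dphi x d) (dphi x a) m + hess x d a m = D x (christ x (ev d) (ev a)) m"
proof (rule gval_nondeg[of "\<phi> x" "\<lambda>m. christ (\<phi> x) (dphi x d) (dphi x a) m + hess x d a m", OF _ m])
  fix w assume "w \<in> pts N"
  then obtain z where z: "z \<in> pts N" and w: "w = (\<lambda>m. \<Sum>b<N. z b * dphi x b m)"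
    using D_surj[OF x] unfolding D_eq by metis
  have gval_add: "gval N g y (\<lambda>m. v m + v' m) u = gval N g y v u + gval N g y v' u" for y v v' u
    by (simp add: gval_def sum.distrib distrib_left distrib_right)
  have "gval N g (\<phi> x) (\<lambda>m. christ (\<phi> x) (dphi x d) (dphi x a) m + hess x d a m) (dphi x b)
     = gval N g (\<phi> x) (D x (christ x (ev d) (ev a))) (dphi x b)" if b: "b < N" for b
  proof -
    note K = metric_law[OF x da b] metric_law[OF x da(2,1) b] metric_law[OF x b da]
    have "gval N g (\<phi> x) (D x (christ x (ev d) (ev a))) (dphi x b) = gval N g x (christ x (ev d) (ev a)) (ev b)"
      using D_isom[OF x christ_pts ev_pts[OF b]] b by (simp add: D_ev)
    moreover have "hess x a d = hess x d a" "hess x b a = hess x a b" "hess x b d = hess x d b"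
      using hess_sym x da b by blast+
    ultimately show ?thesis
      using K koszul[of x "ev d" "ev a" "ev b"] koszul[of "\<phi> x" "dphi x d" "dphi x a" "dphi x b"]
        gval_sym[of "\<phi> x" "dphi x a" "hess x d b"]
      by (simp add: gval_add)
  qed
  then show "gval N g (\<phi> x) (\<lambda>m. christ (\<phi> x) (dphi x d) (dphi x a) m + hess x d a m) w
     = gval N g (\<phi> x) (D x (christ x (ev d) (ev a))) w"
    unfolding w gval_sum_right by simp
qed

text \<open>\<open>christ_law\<close> contracted with \<open>z\<close> and solved for the second
  derivatives; \<open>riem_law\<close> takes for \<open>z\<close> a value of
  \<open>christ\<close>.\<close>

lemma christ_law_linear:
  assumes x: "x \<in> U" and d: "d < N" and z: "z \<in> pts N" and m: "m < N"
  shows "(\<Sum>c<N. z c * hess x d c m) = D x (christ x (ev d) z) m - christ (\<phi> x) (dphi x d) (D x z) m"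
proof -
  have "(\<Sum>c<N. z c * hess x d c m) = (\<Sum>c<N. z c * D x (christ x (ev d) (ev c)) m) - (\<Sum>c<N. z c * christ (\<phi> x) (dphi x d) (dphi x c) m)"
    unfolding sum_subtractf[symmetric]
    by (intro sum.cong refl) (simp add: christ_law[OF x d _ m, symmetric] algebra_simps)
  also have "(\<Sum>c<N. z c * christ (\<phi> x) (dphi x d) (dphi x c) m) = christ (\<phi> x) (dphi x d) (D x z) m"
    by (simp add: D_eq christ_sum_right)
  also have "(\<Sum>c<N. z c * D x (christ x (ev d) (ev c)) m) = (\<Sum>c<N. \<Sum>b<N. z c * christ x (ev d) (ev c) b * dphi x b m)"
    by (simp add: D_eq sum_distrib_left mult.assoc)
  also have "\<dots> = (\<Sum>b<N. christ x (ev d) (\<lambda>m. \<Sum>c<N. z c * ev c m) b * dphi x b m)"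
    unfolding christ_sum_right sum_distrib_right by (rule sum.swap)
  also have "\<dots> = D x (christ x (ev d) z) m"
    by (simp add: D_eq pts_expand[OF z])
  finally show ?thesis .
qed

lemma dchrist_law:
  assumes x: "x \<in> U" and dab: "d < N" "a < N" "b < N" and m: "m < N"
  shows "dchrist (\<phi> x) (dphi x d) (dphi x a) (dphi x b) m + christ (\<phi> x) (hess x d a) (dphi x b) m
     + christ (\<phi> x) (dphi x a) (hess x d b) m + third x d a b m
     = D x (dchrist x (ev d) (ev a) (ev b)) m + (\<Sum>c<N. christ x (ev a) (ev b) c * hess x d c m)"
proof -
  let ?x = "x(d := x d + 0)"
  have g: "((\<lambda>t. christ (x(d := x d + t)) (ev a) (ev b) c) has_real_derivative dchrist x (ev d) (ev a) (ev b) c) (at 0)"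
    if "c < N" for c
    using christ_DERIV[of "\<lambda>t. x(d := x d + t)" "ev d" "\<lambda>_. ev a" "\<lambda>_. 0" "\<lambda>_. ev b" "\<lambda>_. 0" c] shift_DERIV that
    by (simp add: christ_zero christ_sym[of _ _ "\<lambda>_. 0"])
  have "(dchrist (\<phi> ?x) (dphi x d) (dphi ?x a) (dphi ?x b) m + christ (\<phi> ?x) (hess x d a) (dphi ?x b) m
     + christ (\<phi> ?x) (dphi ?x a) (hess x d b) m) + third x d a b m
     = (\<Sum>c<N. dchrist x (ev d) (ev a) (ev b) c * dphi ?x c m + hess x d c m * christ ?x (ev a) (ev b) c)"
  proof (rule DERIV_eq_near[OF x dab(1)])
    show "christ (\<phi> y) (dphi y a) (dphi y b) m + hess y a b m = (\<Sum>c<N. christ y (ev a) (ev b) c * dphi y c m)" if "y \<in> U" for y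
      using christ_law[OF that dab(2,3) m] by (simp add: D_eq)
    show "((\<lambda>t. christ (\<phi> (x(d := x d + t))) (dphi (x(d := x d + t)) a) (dphi (x(d := x d + t)) b) m
        + hess (x(d := x d + t)) a b m) has_real_derivative
       (dchrist (\<phi> ?x) (dphi x d) (dphi ?x a) (dphi ?x b) m + christ (\<phi> ?x) (hess x d a) (dphi ?x b) m
         + christ (\<phi> ?x) (dphi ?x a) (hess x d b) m) + third x d a b m) (at 0)"
      by (intro DERIV_add christ_DERIV \<phi>_DERIV dphi_DERIV hess_DERIV x dab m)
    show "((\<lambda>t. \<Sum>c<N. christ (x(d := x d + t)) (ev a) (ev b) c * dphi (x(d := x d + t)) c m) has_real_derivative
      (\<Sum>c<N. dchrist x (ev d) (ev a) (ev b) c * dphi ?x c m + hess x d c m * christ ?x (ev a) (ev b) c)) (at 0)"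
      by (intro DERIV_sum DERIV_mult g dphi_DERIV x dab m) auto
  qed
  then show ?thesis by (simp add: D_eq sum.distrib mult.commute)
qed

text \<open>In \<open>half\<close> the second and third derivatives of \<phi> enter symmetrically in
  \<open>d\<close> and \<open>a\<close>, so they cancel in the alternating expression
  \<open>riem\<close>.\<close>

lemma riem_law:
  assumes x: "x \<in> U" and dab: "d < N" "a < N" "b < N" and m: "m < N"
  shows "D x (riem x (ev d) (ev a) (ev b)) m = riem (\<phi> x) (dphi x d) (dphi x a) (dphi x b) m"
proof -
  have half: "D x (dchrist x (ev d) (ev a) (ev b)) m + D x (christ x (ev d) (christ x (ev a) (ev b))) m
     = dchrist (\<phi> x) (dphi x d) (dphi x a) (dphi x b) m + christ (\<phi> x) (dphi x d) (christ (\<phi> x) (dphi x a) (dphi x b)) m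
      + (christ (\<phi> x) (hess x d a) (dphi x b) m + christ (\<phi> x) (dphi x a) (hess x d b) m + christ (\<phi> x) (dphi x d) (hess x a b) m
      + third x d a b m)" if da: "d < N" "a < N" for d a
  proof -
    have "christ (\<phi> x) (dphi x d) (D x (christ x (ev a) (ev b))) m
       = christ (\<phi> x) (dphi x d) (\<lambda>m. christ (\<phi> x) (dphi x a) (dphi x b) m + 1 * hess x a b m) m"
      by (rule fun_cong[OF christ_cong]) (simp_all add: christ_law[OF x da(2) dab(3)])
    then have "christ (\<phi> x) (dphi x d) (D x (christ x (ev a) (ev b))) m
       = christ (\<phi> x) (dphi x d) (christ (\<phi> x) (dphi x a) (dphi x b)) m + christ (\<phi> x) (dphi x d) (hess x a b) m"
      unfolding christ_lin_right by simp
    then show ?thesis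
      using dchrist_law[OF x da dab(3) m] christ_law_linear[OF x da(1) christ_pts m, of x "ev a" "ev b"] by linarith
  qed
  have D_diff: "D x (riem x (ev d) (ev a) (ev b)) m = (D x (dchrist x (ev d) (ev a) (ev b)) m + D x (christ x (ev d) (christ x (ev a) (ev b))) m)
     - (D x (dchrist x (ev a) (ev d) (ev b)) m + D x (christ x (ev a) (christ x (ev d) (ev b))) m)"
    by (simp add: D_eq riem_def sum_subtractf sum.distrib left_diff_distrib distrib_right)
  show ?thesis
    unfolding D_diff half[OF dab(1,2)] half[OF dab(2,1)] hess_sym[OF x dab(2,1)] third_sym[OF x dab(2,3,1)]
    by (simp add: riem_def)
qed

lemma curv_form_zero_basis:
  assumes x: "x \<in> U" and "d < N" "a < N" "b < N" "c < N"
  shows "curv_form 0 (\<phi> x) [dphi x d, dphi x a, dphi x b, dphi x c] = curv_form 0 x [ev d, ev a, ev b, ev c]"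
proof -
  have "curv_form 0 x [ev d, ev a, ev b, ev c] = gval N g (\<phi> x) (D x (riem x (ev d) (ev a) (ev b))) (dphi x c)"
    using assms D_isom[OF x riem_pts ev_pts] by (simp flip: riem_curv_form D_ev)
  also have "\<dots> = gval N g (\<phi> x) (riem (\<phi> x) (dphi x d) (dphi x a) (dphi x b)) (dphi x c)"
    by (rule gval_cong) (simp_all add: riem_law assms)
  finally show ?thesis by (simp add: riem_curv_form)
qed

lemma curv_form_basis_extend:
  assumes basis: "\<And>is. length is = 4 + l \<Longrightarrow> set is \<subseteq> {..<N} \<Longrightarrow> curv_form l (\<phi> x) (map (dphi x) is) = curv_form l x (map ev is)"
    and vs: "length vs = 4 + l" "set vs \<subseteq> pts N"
  shows "curv_form l (\<phi> x) (map (D x) vs) = curv_form l x vs"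
proof -
  \<comment> \<open>The number \<open>n\<close> counts the leading slots that may be arbitrary; the
    induction step expands slot \<open>n\<close> in coordinate vectors.\<close>
  have "curv_form l (\<phi> x) (map (D x) vs) = curv_form l x vs"
    if "n \<le> 4 + l" "length vs = 4 + l" "set vs \<subseteq> pts N" "\<And>j. n \<le> j \<Longrightarrow> j < 4 + l \<Longrightarrow> vs ! j \<in> ev ` {..<N}" for n vs
    using that
  proof (induction n arbitrary: vs)
    case 0
    then have "\<forall>v\<in>set vs. \<exists>i<N. v = ev i" by (force simp: in_set_conv_nth)
    then obtain f where f: "\<And>v. v \<in> set vs \<Longrightarrow> f v < N \<and> v = ev (f v)" by metis
    have vs: "vs = map ev (map f vs)" using f by (auto intro!: map_idI[symmetric])
    have "map (D x) vs = map (dphi x) (map f vs)"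
      using f D_ev by (auto intro!: map_cong) metis
    moreover have "curv_form l (\<phi> x) (map (dphi x) (map f vs)) = curv_form l x (map ev (map f vs))"
      using f 0(2) by (intro basis) auto
    ultimately show ?case using vs by metis
  next
    case (Suc n)
    let ?v = "vs ! n"
    have n: "n < 4 + l" using Suc.prems(1) by simp
    have v: "?v \<in> pts N" using Suc.prems(2,3) n by (metis nth_mem subsetD)
    have IH: "curv_form l (\<phi> x) ((map (D x) vs)[n := dphi x a]) = curv_form l x (vs[n := ev a])" if a: "a < N" for a
    proof -
      have "curv_form l (\<phi> x) (map (D x) (vs[n := ev a])) = curv_form l x (vs[n := ev a])"
      proof (rule Suc.IH)
        show "set (vs[n := ev a]) \<subseteq> pts N"
          using Suc.prems(3) set_update_subset_insert[of vs n "ev a"] ev_pts[OF a] by blast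
        show "vs[n := ev a] ! j \<in> ev ` {..<N}" if "n \<le> j" "j < 4 + l" for j
          using Suc.prems(2,4) that a by (cases "j = n") auto
      qed (use Suc.prems in auto)
      then show ?thesis by (simp add: map_update D_ev a)
    qed
    have "curv_form l (\<phi> x) (map (D x) vs) = curv_form l (\<phi> x) ((map (D x) vs)[n := \<lambda>m. \<Sum>a<N. ?v a * dphi x a m])"
      using Suc.prems(2) n by (simp flip: D_eq map_update)
    also have "\<dots> = (\<Sum>a<N. ?v a * curv_form l (\<phi> x) ((map (D x) vs)[n := dphi x a]))"
      using Suc.prems(2) n by (intro curv_form_slot_sum) auto
    also have "\<dots> = (\<Sum>a<N. ?v a * curv_form l x (vs[n := ev a]))"
      by (simp add: IH)
    also have "\<dots> = curv_form l x (vs[n := \<lambda>m. \<Sum>a<N. ?v a * ev a m])"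
      using Suc.prems(2) n by (intro curv_form_slot_sum[symmetric]) auto
    also have "\<dots> = curv_form l x vs"
      by (simp add: pts_expand[OF v])
    finally show ?case .
  qed
  from this[of "4 + l" vs] vs show ?thesis by simp
qed

text \<open>The identity of order \<open>l\<close> is differentiated in the direction of the last
  index. On both sides \<open>curv_form_DERIV\<close> gives the next order plus slot corrections,
  and the corrections correspond to each other under \<open>D\<close> by
  \<open>christ_law\<close>.\<close>

lemma curv_form_basis:
  assumes "x \<in> U" "length is = 4 + l" "set is \<subseteq> {..<N}"
  shows "curv_form l (\<phi> x) (map (dphi x) is) = curv_form l x (map ev is)"
  using assms
proof (induction l arbitrary: x "is")
  case 0
  then obtain d a b c where "is = [d, a, b, c]"
    by (auto simp: length_Suc_conv numeral_eq_Suc)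
  with 0 curv_form_zero_basis show ?case by simp
next
  case (Suc l)
  obtain js d where is_eq: "is = js @ [d]" and js: "length js = 4 + l"
    using Suc.prems(2) by (cases "is" rule: rev_cases) auto
  have d: "d < N" and jsN: "set js \<subseteq> {..<N}" using Suc.prems(3) is_eq by auto
  have jN: "js ! j < N" if "j < 4 + l" for j
    using jsN js that by (metis lessThan_iff nth_mem subsetD)
  note x = Suc.prems(1)
  let ?x = "\<lambda>t. x(d := x d + t)"
  let ?vs = "map (\<lambda>i t. dphi (?x t) i) js" and ?vs' = "map (\<lambda>i. hess x d i) js"
  let ?ws = "map (\<lambda>i (t::real). ev i) js" and ?ws' = "map (\<lambda>i (m::nat). 0::real) js"
  have "curv_form (Suc l) (\<phi> (?x 0)) (map (\<lambda>v. v 0) ?vs @ [dphi x d])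
       + (\<Sum>j<4 + l. curv_form l (\<phi> (?x 0)) ((map (\<lambda>v. v 0) ?vs)[j := \<lambda>m. (?vs' ! j) m + christ (\<phi> (?x 0)) (dphi x d) ((?vs ! j) 0) m]))
     = curv_form (Suc l) (?x 0) (map (\<lambda>v. v 0) ?ws @ [ev d])
       + (\<Sum>j<4 + l. curv_form l (?x 0) ((map (\<lambda>v. v 0) ?ws)[j := \<lambda>m. (?ws' ! j) m + christ (?x 0) (ev d) ((?ws ! j) 0) m]))"
  proof (rule DERIV_eq_near[OF x d])
    show "curv_form l (\<phi> y) (map (dphi y) js) = curv_form l y (map ev js)" if "y \<in> U" for y
      by (rule Suc.IH[OF that js jsN])
    have "((\<lambda>t. curv_form l (\<phi> (?x t)) (map (\<lambda>v. v t) ?vs)) has_real_derivative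
       curv_form (Suc l) (\<phi> (?x 0)) (map (\<lambda>v. v 0) ?vs @ [dphi x d])
       + (\<Sum>j<4 + l. curv_form l (\<phi> (?x 0)) ((map (\<lambda>v. v 0) ?vs)[j := \<lambda>m. (?vs' ! j) m + christ (\<phi> (?x 0)) (dphi x d) ((?vs ! j) 0) m]))) (at 0)"
      by (rule curv_form_DERIV) (use js jN x d \<phi>_DERIV dphi_DERIV in auto)
    then show "((\<lambda>t. curv_form l (\<phi> (?x t)) (map (dphi (?x t)) js)) has_real_derivative
       curv_form (Suc l) (\<phi> (?x 0)) (map (\<lambda>v. v 0) ?vs @ [dphi x d])
       + (\<Sum>j<4 + l. curv_form l (\<phi> (?x 0)) ((map (\<lambda>v. v 0) ?vs)[j := \<lambda>m. (?vs' ! j) m + christ (\<phi> (?x 0)) (dphi x d) ((?vs ! j) 0) m]))) (at 0)"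
      by (simp add: comp_def)
    have "((\<lambda>t. curv_form l (?x t) (map (\<lambda>v. v t) ?ws)) has_real_derivative
       curv_form (Suc l) (?x 0) (map (\<lambda>v. v 0) ?ws @ [ev d])
       + (\<Sum>j<4 + l. curv_form l (?x 0) ((map (\<lambda>v. v 0) ?ws)[j := \<lambda>m. (?ws' ! j) m + christ (?x 0) (ev d) ((?ws ! j) 0) m]))) (at 0)"
      by (rule curv_form_DERIV) (use js shift_DERIV in auto)
    then show "((\<lambda>t. curv_form l (?x t) (map ev js)) has_real_derivative
       curv_form (Suc l) (?x 0) (map (\<lambda>v. v 0) ?ws @ [ev d])
       + (\<Sum>j<4 + l. curv_form l (?x 0) ((map (\<lambda>v. v 0) ?ws)[j := \<lambda>m. (?ws' ! j) m + christ (?x 0) (ev d) ((?ws ! j) 0) m]))) (at 0)"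
      by (simp add: comp_def)
  qed
  moreover have "curv_form l (\<phi> x) ((map (dphi x) js)[j := \<lambda>m. hess x d (js ! j) m + christ (\<phi> x) (dphi x d) (dphi x (js ! j)) m])
     = curv_form l x ((map ev js)[j := christ x (ev d) (ev (js ! j))])" if j: "j < 4 + l" for j
  proof -
    have "(\<lambda>m. hess x d (js ! j) m + christ (\<phi> x) (dphi x d) (dphi x (js ! j)) m) = D x (christ x (ev d) (ev (js ! j)))"
    proof
      fix m
      show "hess x d (js ! j) m + christ (\<phi> x) (dphi x d) (dphi x (js ! j)) m = D x (christ x (ev d) (ev (js ! j))) m"
        using christ_law[OF x d jN[OF j], of m] by (cases "m < N") (auto simp: hess_def dmap_def)
    qed
    moreover have "map (dphi x) js = map (D x) (map ev js)"
      using jsN D_ev by auto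
    \<comment> \<open>The corrected slot is in general no coordinate vector, so the induction
      hypothesis is first extended by multilinearity.\<close>
    moreover have "curv_form l (\<phi> x) (map (D x) ((map ev js)[j := christ x (ev d) (ev (js ! j))]))
       = curv_form l x ((map ev js)[j := christ x (ev d) (ev (js ! j))])"
    proof (rule curv_form_basis_extend)
      show "set ((map ev js)[j := christ x (ev d) (ev (js ! j))]) \<subseteq> pts N"
        using jsN by (intro order_trans[OF set_update_subset_insert]) (auto intro: ev_pts christ_pts)
    qed (simp_all add: Suc.IH[OF x] js)
    ultimately show ?thesis by (simp only: map_update)
  qed
  ultimately show ?case
    using js by (simp add: is_eq comp_def)
qed

lemma model_iso_local:
  assumes "x \<in> U"
  shows "model_iso N g x g (\<phi> x) (\<lambda>b a. pd (\<lambda>y. \<phi> y b) a x) l"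
proof -
  have D: "lin_map N (\<lambda>b a. pd (\<lambda>y. \<phi> y b) a x) = D x"
    using D_lin_map by auto
  show ?thesis
    unfolding model_iso_def D
    using D_isom[OF assms] curv_form_basis_extend[OF curv_form_basis[OF assms]]
    by (auto simp: tensor_at_curv_form)
qed

end

theorem theorem1p8:
  fixes k :: nat and eps :: "nat \<Rightarrow> real" and F :: "nat \<Rightarrow> real \<Rightarrow> real"
  assumes "k \<ge> 1"
    and "\<forall>i\<in>{1..k}. eps i = 1 \<or> eps i = -1"
    and "admissible k F"
  shows "(\<forall>l\<ge>1. \<forall>F' P Q A. admissible k F' \<and> P \<in> pts (3*k+2) \<and> Q \<in> pts (3*k+2) \<and>
            model_iso (3*k+2) (gF k eps F) P (gF k eps F') Q A l
            \<longrightarrow> beta l F k P = beta l F' k Q)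
       \<and> (\<forall>l\<ge>1. curv_homog (3*k+2) (gF k eps F) l \<longrightarrow>
            (\<forall>p\<in>{1..l}. \<forall>P\<in>pts (3*k+2). \<forall>Q\<in>pts (3*k+2). beta p F k P = beta p F k Q))
       \<and> (loc_homog (3*k+2) (gF k eps F) \<longrightarrow>
            (\<forall>l\<ge>1. \<forall>P\<in>pts (3*k+2). \<forall>Q\<in>pts (3*k+2). beta l F k P = beta l F k Q))"
proof -
  have wave: "plane_wave k eps G" if "admissible k G" for G
    using assms(2) that by unfold_locales auto
  interpret plane_wave k eps F by (rule wave[OF assms(3)])
  have beta_iso: "beta l F k P = beta l F' k Q"
    if "l \<ge> 1" "admissible k F'" "model_iso (3*k+2) (gF k eps F) P (gF k eps F') Q A l" for l F' P Q A
  proof -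
    interpret W: wave_pair k eps F F'
      using wave[OF assms(3)] wave[OF that(2)] by (simp add: wave_pair_def)
    show ?thesis
      using W.model_iso_beta[OF assms(1) that(1)] that(3) by (simp add: N_def)
  qed
  \<comment> \<open>An isometry that matches all orders up to \<open>l\<close> also matches those up
    to \<open>p\<close>, so curvature homogeneity of order \<open>l\<close> covers every smaller
    invariant.\<close>
  have mono: "model_iso n g P g Q A p" if "model_iso n g P g Q A l" "p \<le> l" for n P Q A p l
    using that unfolding model_iso_def by auto
  show ?thesis
  proof (intro conjI allI ballI impI)
    fix l F' P Q A
    assume "1 \<le> l" "admissible k F' \<and> P \<in> pts (3*k+2) \<and> Q \<in> pts (3*k+2) \<and>
            model_iso (3*k+2) (gF k eps F) P (gF k eps F') Q A l"
    then show "beta l F k P = beta l F' k Q" using beta_iso by blast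
  next
    fix l p P Q
    assume "curv_homog (3*k+2) (gF k eps F) l" "p \<in> {1..l}" "P \<in> pts (3*k+2)" "Q \<in> pts (3*k+2)"
    then obtain A where "model_iso (3*k+2) g P g Q A p" "1 \<le> p"
      unfolding curv_homog_def using mono by (metis atLeastAtMost_iff)
    then show "beta p F k P = beta p F k Q" using beta_iso assms(3) by blast
  next
    fix l :: nat and P Q
    assume hom: "loc_homog (3*k+2) (gF k eps F)" and l: "1 \<le> l" and "P \<in> pts (3*k+2)" "Q \<in> pts (3*k+2)"
    then obtain U V \<phi> where UV: "P \<in> U" "\<phi> P = Q" "loc_isom (3*k+2) g U V \<phi>"
      unfolding loc_homog_def by blast
    interpret wave_isometry k eps F U V \<phi>
      by unfold_locales (use UV in \<open>simp add: N_def\<close>)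
    show "beta l F k P = beta l F k Q"
      using beta_iso[OF l assms(3)] model_iso_local[OF UV(1), of l] UV(2) by (simp add: N_def)
  qed
qed

end
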